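(* Let $G$ be any locally finite, connected graph that is transient for simple random walk. For every cluster observable $F:\mathcal X\to\mathbb C$ of subexponential growth and every $X\in\mathcal X$, the function $\overline F^X(h)=\mathbb E\big[F(\mathcal C_X(h))\mathbf 1_{\{|\mathcal C_X(h)|<\infty\}}\big]$ is well-defined and analytic on $(-\infty,0)$.
   Context: For $G=(V,E)$, let $P_x$ be the law of simple random walk $(X_n)$ started at $x$, $d(y)$ the degree of $y$, and $g(x,y)=\frac{1}{d(y)}\sum_{n\ge0}P_x[X_n=y]$. The GFF $\varphi$ is the centered Gaussian field on $V$ with covariance $g$. Clusters are connected components of the induced subgraph $\{\varphi\ge h\}$. $\mathcal X$ is the family of finite subsets of $V$; for $X\in\mathcal X$, $\mathcal C_X(h)$ is the union of the clusters of $\{\varphi\ge h\}$ intersecting $X$. For $S\subset V$, $\partial^{out}S=\{x\in V\setminus S:\exists y\in S,x\sim y\}$, $\overline S=S\cup\partial^{out}S$. For finite $K$, $\mathrm{cap}(K)=\sum_{x\in K}d(x)P_x[\widetilde H_K=\infty]$, $\widetilde H_K=\min\{n\ge1:X_n\in K\}$. A cluster observable $F:\mathcal X\to\mathbb C$ has subexponential growth if for every $\eta>0$ there is $C_\eta<\infty$ with $|F(S)|\le C_\eta e^{\eta\,\mathrm{cap}(\overline S)}$ for all $S\in\mathcal X$. *)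

theory Defs
  imports "HOL-Probability.Probability"
begin

text \<open>Graphs: vertex type 'v (V = UNIV), adjacency relation E.\<close>

definition nbrs :: "('v \<Rightarrow> 'v \<Rightarrow> bool) \<Rightarrow> 'v \<Rightarrow> 'v set" where
  "nbrs E x = {y. E x y}"

definition deg :: "('v \<Rightarrow> 'v \<Rightarrow> bool) \<Rightarrow> 'v \<Rightarrow> nat" where
  "deg E x = card (nbrs E x)"

fun srw_p :: "('v \<Rightarrow> 'v \<Rightarrow> bool) \<Rightarrow> nat \<Rightarrow> 'v \<Rightarrow> 'v \<Rightarrow> real" where
  "srw_p E 0 x y = (if x = y then 1 else 0)"
| "srw_p E (Suc n) x y = (\<Sum>z\<in>nbrs E x. srw_p E n z y) / real (deg E x)"

definition green :: "('v \<Rightarrow> 'v \<Rightarrow> bool) \<Rightarrow> 'v \<Rightarrow> 'v \<Rightarrow> real" where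
  "green E x y = (\<Sum>n. srw_p E n x y) / real (deg E y)"

definition transient :: "('v \<Rightarrow> 'v \<Rightarrow> bool) \<Rightarrow> bool" where
  "transient E \<longleftrightarrow> (\<forall>x. summable (\<lambda>n. srw_p E n x x))"

text \<open>avoid E K n x = P_x[X_1,...,X_n \<notin> K].\<close>
fun avoid :: "('v \<Rightarrow> 'v \<Rightarrow> bool) \<Rightarrow> 'v set \<Rightarrow> nat \<Rightarrow> 'v \<Rightarrow> real" where
  "avoid E K 0 x = 1"
| "avoid E K (Suc n) x = (\<Sum>z\<in>nbrs E x. if z \<in> K then 0 else avoid E K n z) / real (deg E x)"

text \<open>Escape probability P_x[tilde H_K = \<infinity>] (limit of the decreasing sequence avoid E K n x).\<close>
definition escape :: "('v \<Rightarrow> 'v \<Rightarrow> bool) \<Rightarrow> 'v set \<Rightarrow> 'v \<Rightarrow> real" where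
  "escape E K x = (INF n. avoid E K n x)"

definition cap :: "('v \<Rightarrow> 'v \<Rightarrow> bool) \<Rightarrow> 'v set \<Rightarrow> real" where
  "cap E K = (\<Sum>x\<in>K. real (deg E x) * escape E K x)"

definition out_boundary :: "('v \<Rightarrow> 'v \<Rightarrow> bool) \<Rightarrow> 'v set \<Rightarrow> 'v set" where
  "out_boundary E S = {x. x \<notin> S \<and> (\<exists>y\<in>S. E x y)}"

definition sclosure :: "('v \<Rightarrow> 'v \<Rightarrow> bool) \<Rightarrow> 'v set \<Rightarrow> 'v set" where
  "sclosure E S = S \<union> out_boundary E S"

definition subexp_growth :: "('v \<Rightarrow> 'v \<Rightarrow> bool) \<Rightarrow> ('v set \<Rightarrow> complex) \<Rightarrow> bool" where
  "subexp_growth E F \<longleftrightarrow>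
     (\<forall>\<eta>>0. \<exists>C. \<forall>S. finite S \<longrightarrow> norm (F S) \<le> C * exp (\<eta> * cap E (sclosure E S)))"

text \<open>Gaussian free field: a family of real random variables on a probability space M such that
  every finite linear combination is centered Gaussian with variance given by the Green function
  (characterised via the characteristic function, which also covers the degenerate case).\<close>
definition is_gff :: "('v \<Rightarrow> 'v \<Rightarrow> bool) \<Rightarrow> 'w measure \<Rightarrow> ('v \<Rightarrow> 'w \<Rightarrow> real) \<Rightarrow> bool" where
  "is_gff E M \<phi> \<longleftrightarrow> prob_space M \<and> (\<forall>x. \<phi> x \<in> borel_measurable M) \<and>
     (\<forall>S a. finite S \<longrightarrow> (\<forall>t::real.
        char (distr M borel (\<lambda>\<omega>. \<Sum>x\<in>S. a x * \<phi> x \<omega>)) t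
          = exp (- complex_of_real (t\<^sup>2 * (\<Sum>x\<in>S. \<Sum>y\<in>S. a x * a y * green E x y) / 2))))"

definition clusters_of :: "('v \<Rightarrow> 'v \<Rightarrow> bool) \<Rightarrow> 'v set \<Rightarrow> 'v set \<Rightarrow> 'v set" where
  "clusters_of E A X = {y. \<exists>x\<in>X. x \<in> A \<and> (\<lambda>u v. E u v \<and> u \<in> A \<and> v \<in> A)\<^sup>*\<^sup>* x y}"

definition level_cluster :: "('v \<Rightarrow> 'v \<Rightarrow> bool) \<Rightarrow> ('v \<Rightarrow> 'w \<Rightarrow> real) \<Rightarrow> 'v set \<Rightarrow> real \<Rightarrow> 'w \<Rightarrow> 'v set" where
  "level_cluster E \<phi> X h \<omega> = clusters_of E {v. h \<le> \<phi> v \<omega>} X"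

definition real_analytic_on :: "(real \<Rightarrow> complex) \<Rightarrow> real set \<Rightarrow> bool" where
  "real_analytic_on f A \<longleftrightarrow> (\<forall>h0\<in>A. \<exists>r>0. \<exists>c::nat \<Rightarrow> complex.
      \<forall>h. \<bar>h - h0\<bar> < r \<longrightarrow> (\<lambda>n. c n * complex_of_real ((h - h0) ^ n)) sums f h)"

end

theory Submission
  imports Defs "HOL-Complex_Analysis.Complex_Analysis"
begin

text \<open>
  Let \<open>S\<close> be a possible value of the cluster, \<open>K = sclosure E S \<union> X\<close>, and let \<open>e\<close> be the equilibrium
  measure of \<open>K\<close>, of total mass \<open>c = cap E K\<close>.  Its potential is 1 on \<open>K\<close>, so the Cameron-Martin
  formula for the shift of the field by the constant \<open>h\<close> on \<open>K\<close> reads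
  \<open>P[C(h) = S] = E[exp (- h * Y - h\<^sup>2 * c / 2); C(0) = S]\<close> with \<open>Y = \<Sum>x\<in>K. e x * \<phi> x\<close>.
  The right-hand side is entire in \<open>h\<close>.  Neighbours of points of \<open>S\<close> lie in \<open>K\<close>, hence \<open>e\<close> vanishes
  on \<open>S\<close>, and on \<open>C(0) = S\<close> the field is negative on the rest of \<open>K\<close>; thus \<open>Y \<le> 0\<close> there.  For
  \<open>Re z < 0\<close> the extension is therefore bounded by \<open>exp (- ((Re z)\<^sup>2 - (Im z)\<^sup>2) * c / 2) * P[C(0) = S]\<close>.
  Near a negative \<open>h\<close> the exponential factor beats the growth of \<open>F\<close>, the probabilities sum to at
  most 1, and the series of analytic functions \<open>F(S) * P[C(h) = S]\<close> converges uniformly.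
\<close>

section \<open>Potential theory of the simple random walk\<close>

locale transient_graph =
  fixes E :: "'v \<Rightarrow> 'v \<Rightarrow> bool"
  assumes sym: "\<And>x y. E x y \<Longrightarrow> E y x"
    and locfin: "\<And>x. finite (nbrs E x)"
    and conn: "\<And>x y. E\<^sup>*\<^sup>* x y"
    and nonisol: "\<And>x. nbrs E x \<noteq> {}"
    and trans: "transient E"
begin

section \<open>Transition probabilities, reversibility and the Green function\<close>

lemma deg_pos: "0 < deg E x"
  using locfin nonisol by (simp add: deg_def card_gt_0_iff)

lemma nbrs_sym: "y \<in> nbrs E x \<longleftrightarrow> x \<in> nbrs E y"
  using sym by (auto simp: nbrs_def)

lemma srw_p_nonneg: "0 \<le> srw_p E n x y"
  by (induction n arbitrary: x) (auto intro!: divide_nonneg_nonneg sum_nonneg)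

text \<open>Transience gives the diagonal case, which spreads along a path from \<open>y\<close> to
  \<open>x\<close>: a step from \<open>x\<close> to its neighbour \<open>z\<close> has probability
  \<open>1 / deg E x\<close>, so the series at \<open>z\<close> is dominated by
  \<open>deg E x\<close> times the shifted series at \<open>x\<close>.\<close>

lemma summable_srw_p: "summable (\<lambda>n. srw_p E n x y)"
proof -
  have "E\<^sup>*\<^sup>* y x" by (rule conn)
  then show ?thesis
  proof induction
    case base
    then show ?case using trans by (simp add: transient_def)
  next
    case (step x z)
    have le: "norm (srw_p E n z y) \<le> real (deg E x) * srw_p E (Suc n) x y" for n
    proof -
      have "srw_p E n z y \<le> (\<Sum>w\<in>nbrs E x. srw_p E n w y)"
        using step(2) by (intro member_le_sum locfin srw_p_nonneg) (auto simp: nbrs_def)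
      then show ?thesis using deg_pos[of x] by (simp add: srw_p_nonneg)
    qed
    have "summable (\<lambda>n. srw_p E (Suc n) x y)"
      using step.IH by (subst summable_Suc_iff)
    then have "summable (\<lambda>n. real (deg E x) * srw_p E (Suc n) x y)"
      by (rule summable_mult)
    then show ?case
      by (rule summable_comparison_test') (rule le)
  qed
qed

text \<open>The definition of \<open>srw_p\<close> splits off the first step of the walk; here the
  last step is split off, from a neighbour \<open>z\<close> of \<open>x\<close>.\<close>

lemma srw_p_Suc_right: "srw_p E (Suc n) y x = (\<Sum>z\<in>nbrs E x. srw_p E n y z / real (deg E z))"
proof (induction n arbitrary: y)
  case 0
  have "(\<Sum>z\<in>nbrs E x. srw_p E 0 y z / real (deg E z))
      = (\<Sum>z\<in>nbrs E x. if z = y then 1 / real (deg E y) else 0)"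
    by (intro sum.cong) auto
  also have "\<dots> = (if y \<in> nbrs E x then 1 / real (deg E y) else 0)"
    using locfin by (subst sum.delta) auto
  finally show ?case using locfin by (simp add: nbrs_sym[of y x] sum.delta)
next
  case (Suc n)
  have "srw_p E (Suc (Suc n)) y x
      = (\<Sum>w\<in>nbrs E y. \<Sum>z\<in>nbrs E x. srw_p E n w z / real (deg E z)) / real (deg E y)"
    using Suc.IH by simp
  also have "\<dots> = (\<Sum>z\<in>nbrs E x. srw_p E (Suc n) y z / real (deg E z))"
    by (subst sum.swap) (simp add: sum_divide_distrib mult.commute)
  finally show ?case .
qed

text \<open>The degrees form a reversible measure. In the induction a first step from
  \<open>x\<close> on one side becomes a last step into \<open>x\<close> on the other.\<close>

lemma srw_p_reversible: "real (deg E x) * srw_p E n x y = real (deg E y) * srw_p E n y x"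
proof (induction n arbitrary: x)
  case 0
  then show ?case by simp
next
  case (Suc n)
  have "srw_p E n z y = real (deg E y) * srw_p E n y z / real (deg E z)" for z
    using Suc[of z] deg_pos[of z] by (simp add: field_simps)
  then have "real (deg E x) * srw_p E (Suc n) x y
      = (\<Sum>z\<in>nbrs E x. real (deg E y) * srw_p E n y z / real (deg E z))"
    using deg_pos[of x] by simp
  also have "\<dots> = real (deg E y) * srw_p E (Suc n) y x"
    by (subst srw_p_Suc_right) (simp add: sum_distrib_left)
  finally show ?case .
qed

lemma green_sym: "green E x y = green E y x"
proof -
  have "real (deg E x) * (\<Sum>n. srw_p E n x y) = real (deg E y) * (\<Sum>n. srw_p E n y x)"
    by (simp add: suminf_mult[OF summable_srw_p, symmetric] srw_p_reversible)
  then show ?thesis using deg_pos[of x] deg_pos[of y] by (simp add: green_def field_simps)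
qed

section \<open>Escape probabilities and the last-exit decomposition\<close>

lemma avoid_nonneg: "0 \<le> avoid E K n x"
  by (induction n arbitrary: x) (auto intro!: divide_nonneg_nonneg sum_nonneg)

lemma avoid_le_1: "avoid E K n x \<le> 1"
proof (induction n arbitrary: x)
  case (Suc n)
  have "(\<Sum>z\<in>nbrs E x. if z \<in> K then 0 else avoid E K n z) \<le> (\<Sum>z\<in>nbrs E x. 1)"
    by (intro sum_mono) (use Suc in auto)
  then show ?case using deg_pos[of x] by (simp add: deg_def)
qed simp

lemma avoid_Suc_le: "avoid E K (Suc n) x \<le> avoid E K n x"
proof (induction n arbitrary: x)
  case 0
  then show ?case using avoid_le_1[of K "Suc 0" x] by simp
next
  case (Suc n)
  have "(\<Sum>z\<in>nbrs E x. if z \<in> K then 0 else avoid E K (Suc n) z)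
      \<le> (\<Sum>z\<in>nbrs E x. if z \<in> K then 0 else avoid E K n z)"
    by (intro sum_mono) (use Suc in auto)
  then show ?case by (auto intro!: divide_right_mono)
qed

lemma avoid_tendsto_escape: "(\<lambda>n. avoid E K n x) \<longlonglongrightarrow> escape E K x"
  unfolding escape_def
  by (rule LIMSEQ_decseq_INF) (auto intro!: bdd_belowI[of _ 0] decseq_SucI avoid_Suc_le avoid_nonneg simp del: avoid.simps)

lemma escape_nonneg: "0 \<le> escape E K x"
  by (rule LIMSEQ_le_const[OF avoid_tendsto_escape]) (auto intro: avoid_nonneg)

text \<open>The first step of the walk already lands in \<open>K\<close>.\<close>

lemma escape_interior:
  assumes "nbrs E x \<subseteq> K"
  shows "escape E K x = 0"
proof -
  have "avoid E K (Suc n) x = 0" for n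
    using assms by (auto intro!: sum.neutral)
  then have "(\<lambda>n. avoid E K (Suc n) x) \<longlonglongrightarrow> 0" by (simp del: avoid.simps)
  then show ?thesis
    using avoid_tendsto_escape[of K x, THEN LIMSEQ_Suc] LIMSEQ_unique by blast
qed

text \<open>Decomposition at the last visit to \<open>K\<close> before time \<open>N\<close>.\<close>

lemma last_exit_finite:
  assumes "finite K"
  shows "(\<Sum>n\<le>N. \<Sum>x\<in>K. srw_p E n y x * avoid E K (N - n) x)
    = (if y \<in> K then 1 else 1 - avoid E K N y)"
proof (induction N arbitrary: y)
  case 0
  have "(\<Sum>x\<in>K. if y = x then 1 else 0) = (if y \<in> K then 1 else (0::real))"
    using assms by (subst sum.delta') auto
  then show ?case by simp
next
  case (Suc N)
  have d: "real (deg E y) \<noteq> 0" using deg_pos[of y] by simp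
  \<comment> \<open>Last visits at positive times: condition on the first step and apply the
    induction hypothesis at each neighbour.\<close>
  have "(\<Sum>n\<le>N. \<Sum>x\<in>K. srw_p E (Suc n) y x * avoid E K (N - n) x)
      = (\<Sum>n\<le>N. \<Sum>x\<in>K. \<Sum>z\<in>nbrs E y. srw_p E n z x * avoid E K (N - n) x) / real (deg E y)"
    by (simp add: sum_divide_distrib sum_distrib_right)
  also have "\<dots> = (\<Sum>z\<in>nbrs E y. \<Sum>n\<le>N. \<Sum>x\<in>K. srw_p E n z x * avoid E K (N - n) x) / real (deg E y)"
    by (subst sum.swap[of _ "{..N}" "nbrs E y"])
      (intro arg_cong2[where f="(/)"] sum.cong refl sum.swap)
  also have "\<dots> = (\<Sum>z\<in>nbrs E y. 1 - (if z \<in> K then 0 else avoid E K N z)) / real (deg E y)"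
    unfolding Suc.IH by (intro arg_cong2[where f="(/)"] sum.cong) auto
  also have "\<dots> = 1 - avoid E K (Suc N) y"
    using d by (simp add: sum_subtractf deg_def diff_divide_distrib)
  finally have *: "(\<Sum>n\<le>N. \<Sum>x\<in>K. srw_p E (Suc n) y x * avoid E K (N - n) x)
      = 1 - avoid E K (Suc N) y" .
  \<comment> \<open>A last visit at time 0 is possible only for \<open>y\<close> in
    \<open>K\<close>; its probability completes the sum to 1.\<close>
  have "(\<Sum>x\<in>K. srw_p E 0 y x * avoid E K (Suc N) x)
      = (\<Sum>x\<in>K. if x = y then avoid E K (Suc N) y else 0)"
    by (intro sum.cong) (auto simp del: avoid.simps)
  also have "\<dots> = (if y \<in> K then avoid E K (Suc N) y else 0)"
    using assms by (subst sum.delta) auto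
  finally have "(\<Sum>x\<in>K. srw_p E 0 y x * avoid E K (Suc N) x)
      = (if y \<in> K then avoid E K (Suc N) y else 0)" .
  then show ?case
    by (subst sum.atMost_Suc_shift) (simp add: * del: avoid.simps srw_p.simps)
qed

text \<open>Dominated convergence for series: each summand converges as N grows, and
  \<open>avoid\<close> is at most 1, so the summable sequence \<open>srw_p E n y x\<close>
  dominates.\<close>

lemma convolution_tendsto:
  "(\<lambda>N. \<Sum>n\<le>N. srw_p E n y x * avoid E K (N - n) x) \<longlonglongrightarrow> (\<Sum>n. srw_p E n y x) * escape E K x"
proof -
  let ?a = "\<lambda>n N. if n \<le> N then srw_p E n y x * avoid E K (N - n) x else 0"
  have lim: "(\<lambda>N. ?a n N) \<longlonglongrightarrow> srw_p E n y x * escape E K x" for n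
  proof (rule LIMSEQ_offset[of _ n])
    show "(\<lambda>N. ?a n (N + n)) \<longlonglongrightarrow> srw_p E n y x * escape E K x"
      by (simp add: tendsto_mult_left avoid_tendsto_escape)
  qed
  have le: "norm (?a n N) \<le> srw_p E n y x" for n N
    using mult_left_mono[OF avoid_le_1[of K "N - n" x] srw_p_nonneg[of n y x]]
    by (auto simp: abs_mult srw_p_nonneg avoid_nonneg)
  have "(\<lambda>N. \<Sum>n. ?a n N) \<longlonglongrightarrow> (\<Sum>n. srw_p E n y x * escape E K x)"
    using tannerys_theorem[where a = ?a and F = sequentially and M = "\<lambda>n. srw_p E n y x",
        OF lim _ summable_srw_p] le
    by (simp add: case_prod_unfold)
  moreover have "(\<Sum>n. ?a n N) = (\<Sum>n\<le>N. srw_p E n y x * avoid E K (N - n) x)" for N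
    by (subst suminf_finite[of "{..N}"]) auto
  moreover have "(\<Sum>n. srw_p E n y x * escape E K x) = (\<Sum>n. srw_p E n y x) * escape E K x"
    by (rule suminf_mult2[OF summable_srw_p, symmetric])
  ultimately show ?thesis by simp
qed

section \<open>Equilibrium measure, its potential, and capacity\<close>

definition equi :: "'v set \<Rightarrow> 'v \<Rightarrow> real" where
  "equi K x = real (deg E x) * escape E K x"

lemma equi_nonneg: "0 \<le> equi K x"
  by (simp add: equi_def escape_nonneg)

lemma equi_interior: "nbrs E x \<subseteq> K \<Longrightarrow> equi K x = 0"
  by (simp add: equi_def escape_interior)

lemma cap_eq: "cap E K = (\<Sum>x\<in>K. equi K x)"
  by (simp add: cap_def equi_def)

text \<open>The limit of \<open>last_exit_finite\<close> as N tends to infinity. The degree in the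
  denominator of \<open>green\<close> cancels the one in \<open>equi\<close>.\<close>

lemma last_exit_tendsto:
  assumes "finite K"
  shows "(\<lambda>N. if y \<in> K then 1 else 1 - avoid E K N y) \<longlonglongrightarrow> (\<Sum>x\<in>K. green E y x * equi K x)"
proof -
  have "(\<lambda>N. \<Sum>x\<in>K. \<Sum>n\<le>N. srw_p E n y x * avoid E K (N - n) x)
      \<longlonglongrightarrow> (\<Sum>x\<in>K. (\<Sum>n. srw_p E n y x) * escape E K x)"
    by (intro tendsto_sum convolution_tendsto)
  moreover have "(\<Sum>x\<in>K. (\<Sum>n. srw_p E n y x) * escape E K x) = (\<Sum>x\<in>K. green E y x * equi K x)"
    by (intro sum.cong) (simp_all add: green_def equi_def deg_pos[THEN gr_implies_not0])
  ultimately show ?thesis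
    by (subst (asm) sum.swap) (simp add: last_exit_finite[OF assms])
qed

lemma equilibrium_potential:
  assumes "finite K" "y \<in> K"
  shows "(\<Sum>x\<in>K. green E y x * equi K x) = 1"
  using last_exit_tendsto[OF assms(1), of y] assms(2) by (simp add: LIMSEQ_const_iff)

lemma equilibrium_potential_le_1:
  assumes "finite K"
  shows "(\<Sum>x\<in>K. green E y x * equi K x) \<le> 1"
  by (rule LIMSEQ_le_const2[OF last_exit_tendsto[OF assms, of y]]) (auto simp: avoid_nonneg)

text \<open>On \<open>K\<close> the constant 1 is the potential of the equilibrium measure of
  \<open>L\<close>. Symmetry of \<open>green\<close> moves the potential onto the measure of
  \<open>K\<close>, where it is at most 1.\<close>

lemma cap_mono:
  assumes "finite L" "K \<subseteq> L"
  shows "cap E K \<le> cap E L"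
proof -
  have fK: "finite K" using assms finite_subset by blast
  have "cap E K = (\<Sum>x\<in>K. equi K x * (\<Sum>y\<in>L. green E x y * equi L y))"
    using assms by (auto simp: cap_eq equilibrium_potential intro!: sum.cong)
  also have "\<dots> = (\<Sum>y\<in>L. equi L y * (\<Sum>x\<in>K. green E y x * equi K x))"
    unfolding sum_distrib_left
    by (subst sum.swap) (auto intro!: sum.cong simp: green_sym)
  also have "\<dots> \<le> (\<Sum>y\<in>L. equi L y * 1)"
    by (intro sum_mono mult_left_mono equilibrium_potential_le_1 fK equi_nonneg)
  finally show ?thesis by (simp add: cap_eq)
qed

text \<open>With zero capacity the equilibrium measure would vanish, and so would its potential,
  which is 1 on \<open>K\<close>.\<close>

lemma cap_pos:
  assumes "finite K" "K \<noteq> {}"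
  shows "0 < cap E K"
proof (rule ccontr)
  assume "\<not> 0 < cap E K"
  then have "(\<Sum>x\<in>K. equi K x) = 0"
    using sum_nonneg[of K "equi K"] equi_nonneg by (force simp: cap_eq)
  then have "\<forall>x\<in>K. equi K x = 0"
    using assms equi_nonneg by (simp add: sum_nonneg_eq_0_iff)
  then have "(\<Sum>x\<in>K. green E y x * equi K x) = 0" for y by simp
  with equilibrium_potential[OF assms(1)] assms(2) show False by auto
qed

section \<open>Closures of finite sets and countability of the graph\<close>

lemma finite_sclosure:
  assumes "finite S"
  shows "finite (sclosure E S)"
proof -
  have "sclosure E S \<subseteq> S \<union> (\<Union>x\<in>S. nbrs E x)"
    by (auto simp: sclosure_def out_boundary_def nbrs_def dest: sym)
  then show ?thesis by (rule finite_subset) (use assms locfin in auto)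
qed

lemma nbrs_subset_sclosure:
  assumes "x \<in> S"
  shows "nbrs E x \<subseteq> sclosure E S"
proof
  fix y assume "y \<in> nbrs E x"
  then have "E y x" using sym by (simp add: nbrs_def)
  with assms show "y \<in> sclosure E S" by (auto simp: sclosure_def out_boundary_def)
qed

text \<open>Local finiteness makes the set \<open>B n\<close> of endpoints of n-step paths from a
  fixed vertex finite, and connectedness makes these sets cover the graph. Hence the finite clusters
  can be enumerated.\<close>

lemma countable_vertices: "countable (UNIV :: 'v set)"
proof -
  obtain o' :: 'v where True by blast
  define B where "B = rec_nat {o'} (\<lambda>_ A. \<Union>x\<in>A. nbrs E x)"
  have B: "B 0 = {o'}" "B (Suc n) = (\<Union>x\<in>B n. nbrs E x)" for n
    by (simp_all add: B_def)
  have "finite (B n)" for n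
    by (induction n) (auto simp: B locfin)
  then have "countable (\<Union>n. B n)" by (auto intro: countable_finite)
  moreover have "x \<in> (\<Union>n. B n)" for x
    using conn[of o' x]
  proof induction
    case base
    have "o' \<in> B 0" by (simp add: B)
    then show ?case by blast
  next
    case (step y z)
    then obtain n where "y \<in> B n" by blast
    with step have "z \<in> B (Suc n)" by (auto simp: B nbrs_def)
    then show ?case by blast
  qed
  ultimately show ?thesis by (metis UNIV_eq_I)
qed

end

section \<open>Clusters\<close>

lemma clusters_of_subset: "clusters_of E A X \<subseteq> A"
proof
  fix y assume "y \<in> clusters_of E A X"
  then obtain x where "x \<in> A" "(\<lambda>u v. E u v \<and> u \<in> A \<and> v \<in> A)\<^sup>*\<^sup>* x y"
    by (auto simp: clusters_of_def)
  from this(2,1) show "y \<in> A" by induction auto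
qed

lemma clusters_of_start: "x \<in> X \<Longrightarrow> x \<in> A \<Longrightarrow> x \<in> clusters_of E A X"
  by (auto simp: clusters_of_def)

lemma clusters_of_step:
  "y \<in> clusters_of E A X \<Longrightarrow> E y z \<Longrightarrow> z \<in> A \<Longrightarrow> z \<in> clusters_of E A X"
  using clusters_of_subset[of E A X] unfolding clusters_of_def
  by (auto intro: rtranclp.rtrancl_into_rtrancl)

text \<open>The minimality principle by which all upper bounds on clusters are proved.\<close>

lemma clusters_of_subsetI:
  assumes "\<And>x. x \<in> X \<Longrightarrow> x \<in> A \<Longrightarrow> x \<in> T"
    and "\<And>y z. y \<in> T \<Longrightarrow> E y z \<Longrightarrow> z \<in> A \<Longrightarrow> z \<in> T"
  shows "clusters_of E A X \<subseteq> T"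
proof
  fix y assume "y \<in> clusters_of E A X"
  then obtain x where "x \<in> X" "x \<in> A" "(\<lambda>u v. E u v \<and> u \<in> A \<and> v \<in> A)\<^sup>*\<^sup>* x y"
    by (auto simp: clusters_of_def)
  from this(3,1,2) show "y \<in> T" by induction (auto intro: assms)
qed

lemma clusters_of_mono: "A \<subseteq> B \<Longrightarrow> clusters_of E A X \<subseteq> clusters_of E B X"
  by (rule clusters_of_subsetI) (meson clusters_of_start clusters_of_step subsetD)+

text \<open>Reduces the cluster event to finitely many sites when \<open>S\<close> and
  \<open>X\<close> are finite: once \<open>S\<close> lies in \<open>A\<close>, exploration from
  \<open>X\<close> stops at \<open>S\<close> exactly when the other points of
  \<open>sclosure E S \<union> X\<close> are outside \<open>A\<close>. The condition
  \<open>clusters_of E S X = S\<close> does not involve \<open>A\<close>.\<close>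

lemma clusters_of_eq_iff:
  assumes sym: "\<And>x y. E x y \<Longrightarrow> E y x"
  shows "clusters_of E A X = S \<longleftrightarrow>
    clusters_of E S X = S \<and> S \<subseteq> A \<and> ((sclosure E S \<union> X) - S) \<inter> A = {}" (is "_ \<longleftrightarrow> ?R")
proof
  assume S: "clusters_of E A X = S"
  have SA: "S \<subseteq> A" using clusters_of_subset[of E A X] S by simp
  have start: "x \<in> S" if "x \<in> X" "x \<in> A" for x
    using clusters_of_start[OF that, of E] S by simp
  have step: "z \<in> S" if "y \<in> S" "E y z" "z \<in> A" for y z
    using clusters_of_step[of y E A X z] that S by simp
  \<comment> \<open>A path in \<open>A\<close> that starts in \<open>X\<close> never leaves
    \<open>S\<close>, so it is also a path inside \<open>S\<close>.\<close>
  have "clusters_of E A X \<subseteq> clusters_of E S X"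
  proof (rule clusters_of_subsetI)
    show "x \<in> clusters_of E S X" if "x \<in> X" "x \<in> A" for x
      using that start[OF that] by (intro clusters_of_start)
    show "z \<in> clusters_of E S X" if y: "y \<in> clusters_of E S X" and "E y z" "z \<in> A" for y z
    proof (rule clusters_of_step[OF y \<open>E y z\<close>])
      have "y \<in> S" using y clusters_of_subset by (rule subsetD[rotated])
      then show "z \<in> S" using \<open>E y z\<close> \<open>z \<in> A\<close> by (rule step)
    qed
  qed
  then have "clusters_of E S X = S"
    using S clusters_of_subset[of E S X] by simp
  moreover have "((sclosure E S \<union> X) - S) \<inter> A = {}"
  proof (intro equals0I)
    fix x assume "x \<in> ((sclosure E S \<union> X) - S) \<inter> A"
    then consider y where "y \<in> S" "E x y" "x \<in> A" "x \<notin> S" | "x \<in> X" "x \<in> A" "x \<notin> S"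
      by (auto simp: sclosure_def out_boundary_def)
    then show False
      by cases (use start step sym in metis)+
  qed
  ultimately show ?R using SA by simp
next
  assume R: ?R
  have "clusters_of E A X \<subseteq> S"
  proof (rule clusters_of_subsetI)
    show "x \<in> S" if "x \<in> X" "x \<in> A" for x using R that by blast
    show "z \<in> S" if "y \<in> S" "E y z" "z \<in> A" for y z
    proof (rule ccontr)
      assume "z \<notin> S"
      then have "z \<in> sclosure E S - S" 
        using that(1) sym[OF that(2)] by (auto simp: sclosure_def out_boundary_def)
      with R that show False by blast
    qed
  qed
  moreover have "S \<subseteq> clusters_of E A X"
    using R clusters_of_mono[of S A E X] by simp
  ultimately show "clusters_of E A X = S" by simp
qed

section \<open>Characteristic functions of random vectors\<close>

text \<open>The case t = 0 shows that the total masses agree; dividing by the common mass reduces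
  the claim to Levy's theorem for probability measures. Zero mass is treated apart.\<close>

lemma finite_measure_char_unique:
  fixes \<mu> \<nu> :: "real measure"
  assumes fin: "finite_measure \<mu>" "finite_measure \<nu>"
    and sets[measurable_cong]: "sets \<mu> = sets borel" "sets \<nu> = sets borel"
    and eq: "\<And>t. (CLINT x|\<mu>. iexp (t * x)) = (CLINT x|\<nu>. iexp (t * x))"
  shows "\<mu> = \<nu>"
proof -
  interpret m: finite_measure \<mu> by fact
  interpret n: finite_measure \<nu> by fact
  have sp: "space \<mu> = UNIV" "space \<nu> = UNIV"
    using sets_eq_imp_space_eq[OF sets(1)] sets_eq_imp_space_eq[OF sets(2)] by auto
  define c where "c = measure \<mu> UNIV"
  have c2: "c = measure \<nu> UNIV"
    using eq[of 0] by (simp add: c_def sp)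
  have c0: "0 \<le> c" by (simp add: c_def)
  show ?thesis
  proof (cases "c = 0")
    case True
    have "emeasure \<mu> A = 0" "emeasure \<nu> A = 0" for A
      using m.bounded_measure[of A] n.bounded_measure[of A] True c2
      by (simp_all add: m.emeasure_eq_measure n.emeasure_eq_measure sp c_def
          measure_le_0_iff)
    then show ?thesis
      by (intro measure_eqI) (simp_all add: sets)
  next
    case False
    with c0 have c: "0 < c" by simp
    have dist: "real_distribution (density \<rho> (\<lambda>_. ennreal (1 / c)))"
      if "finite_measure \<rho>" and s: "sets \<rho> = sets borel" and m: "measure \<rho> UNIV = c" for \<rho> :: "real measure"
    proof -
      interpret finite_measure \<rho> by fact
      have "emeasure \<rho> UNIV = ennreal c"
        using m by (simp add: emeasure_eq_measure)
      then have "emeasure (density \<rho> (\<lambda>_. ennreal (1 / c))) UNIV = 1"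
        using c s by (simp add: emeasure_density_const ennreal_mult[symmetric])
      then have "prob_space (density \<rho> (\<lambda>_. ennreal (1 / c)))"
        by (intro prob_spaceI) (simp add: sets_eq_imp_space_eq[OF s])
      then show ?thesis
        by (simp add: real_distribution_def real_distribution_axioms_def s sets_eq_imp_space_eq[OF s])
    qed
    have char: "char (density \<rho> (\<lambda>_. ennreal (1 / c))) t = (1 / c) *\<^sub>R (CLINT x|\<rho>. iexp (t * x))"
      if [measurable_cong]: "sets \<rho> = sets borel" for \<rho> t
      unfolding char_def using c by (subst integral_density) auto
    have "density \<mu> (\<lambda>_. ennreal (1 / c)) = density \<nu> (\<lambda>_. ennreal (1 / c))"
    proof (rule Levy_uniqueness)
      show "real_distribution (density \<mu> (\<lambda>_. ennreal (1 / c)))"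
        by (intro dist fin sets) (simp add: c_def)
      show "real_distribution (density \<nu> (\<lambda>_. ennreal (1 / c)))"
        by (intro dist fin sets) (simp add: c2)
      show "char (density \<mu> (\<lambda>_. ennreal (1 / c))) = char (density \<nu> (\<lambda>_. ennreal (1 / c)))"
        by (rule ext) (simp only: char[OF sets(1)] char[OF sets(2)] eq)
    qed
    then have e: "emeasure (density \<mu> (\<lambda>_. ennreal (1 / c))) A = emeasure (density \<nu> (\<lambda>_. ennreal (1 / c))) A" for A
      by simp
    have "A \<in> sets borel \<Longrightarrow> ennreal (1 / c) * emeasure \<mu> A = ennreal (1 / c) * emeasure \<nu> A" for A
      using e[of A] by (simp add: emeasure_density_const sets)
    then have "A \<in> sets borel \<Longrightarrow> ennreal c * (ennreal (1 / c) * emeasure \<mu> A) = ennreal c * (ennreal (1 / c) * emeasure \<nu> A)" for A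
      by simp
    then have "A \<in> sets borel \<Longrightarrow> emeasure \<mu> A = emeasure \<nu> A" for A
      using c by (simp add: mult.assoc[symmetric] ennreal_mult[symmetric])
    then show ?thesis by (intro measure_eqI) (simp_all add: sets)
  qed
qed

text \<open>A bounded nonnegative weight is a density, and its image under \<open>Z\<close> is a
  finite measure on the line whose Fourier transform is the weighted integral.\<close>

lemma weighted_char_unique:
  fixes Z :: "'a \<Rightarrow> real" and Z' :: "'b \<Rightarrow> real"
  assumes "finite_measure M" "finite_measure N"
    and [measurable]: "Z \<in> borel_measurable M" "Z' \<in> borel_measurable N"
      "w \<in> borel_measurable M" "w' \<in> borel_measurable N"
    and w: "\<And>x. 0 \<le> w x" "\<And>x. w x \<le> (c::real)" "\<And>x. 0 \<le> w' x" "\<And>x. w' x \<le> c"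
    and eq: "\<And>t. (CLINT x|M. w x *\<^sub>R iexp (t * Z x)) = (CLINT x|N. w' x *\<^sub>R iexp (t * Z' x))"
    and [measurable]: "B \<in> sets borel"
  shows "(\<integral>x. w x * indicator B (Z x) \<partial>M) = (\<integral>x. w' x * indicator B (Z' x) \<partial>N)"
proof -
  have fin: "finite_measure (distr (density L v) borel Y)"
    if "finite_measure L" and [measurable]: "Y \<in> borel_measurable L" "v \<in> borel_measurable L"
      and v: "\<And>x. 0 \<le> v x" "\<And>x. v x \<le> c"
    for L :: "'d measure" and v :: "'d \<Rightarrow> real" and Y :: "'d \<Rightarrow> real"
  proof -
    interpret finite_measure L by fact
    have "(\<integral>\<^sup>+x. ennreal (v x) \<partial>L) \<le> (\<integral>\<^sup>+x. ennreal c \<partial>L)"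
      using v by (intro nn_integral_mono) (simp add: ennreal_leI)
    also have "\<dots> < \<infinity>" by (simp add: ennreal_mult_less_top emeasure_eq_measure)
    finally have "finite_measure (density L v)"
      by (intro finite_measureI) (simp add: emeasure_density cong: nn_integral_cong)
    then show ?thesis
      by (rule finite_measure.finite_measure_distr) simp
  qed
  have "distr (density M w) borel Z = distr (density N w') borel Z'"
  proof (rule finite_measure_char_unique)
    show "finite_measure (distr (density M w) borel Z)" "finite_measure (distr (density N w') borel Z')"
      using assms by (auto intro!: fin)
    fix t
    show "(CLINT x|distr (density M w) borel Z. iexp (t * x))
        = (CLINT x|distr (density N w') borel Z'. iexp (t * x))"
      using eq[of t] w by (simp add: integral_distr integral_density)
  qed simp_all
  then have "(\<integral>x. indicator B x \<partial>distr (density M w) borel Z)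
      = ((\<integral>x. indicator B x \<partial>distr (density N w') borel Z') :: real)"
    by simp
  then show ?thesis
    using w by (simp add: integral_distr integral_density del: Bochner_Integration.integral_indicator)
qed

text \<open>Writes a nonnegative cosine weight in terms of pure exponentials, the only functions
  that the induction below can handle.\<close>

lemma cos_weight_iexp:
  "(r * (1 + cos (u + \<theta>))) *\<^sub>R iexp v = r *\<^sub>R iexp v
     + (iexp \<theta> / 2) * (r *\<^sub>R iexp (u + v)) + (iexp (- \<theta>) / 2) * (r *\<^sub>R iexp (- u + v))"
proof -
  have c: "complex_of_real (cos (u + \<theta>)) = (iexp u * iexp \<theta> + iexp (- u) * iexp (- \<theta>)) / 2"
    by (simp add: complex_eq_iff Re_exp Im_exp cos_add)
  have "iexp (u + v) = iexp u * iexp v" "iexp (- u + v) = iexp (- u) * iexp v"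
    by (simp_all add: exp_add[symmetric] algebra_simps)
  then show ?thesis
    unfolding scaleR_conv_of_real of_real_mult of_real_add c by (simp add: field_simps)
qed

text \<open>The induction replaces exponentials by indicators one coordinate at a time.  The signed
  weights \<open>cos\<close> and \<open>sin\<close> are made nonnegative by adding 1, so that uniqueness for
  positive measures on the line applies.\<close>

lemma joint_char_unique_aux:
  fixes Z :: "'i \<Rightarrow> 'a \<Rightarrow> real" and Z' :: "'i \<Rightarrow> 'b \<Rightarrow> real"
  assumes "prob_space M" "prob_space N" "finite I" "J \<subseteq> I"
    and Z[measurable]: "\<And>i. Z i \<in> borel_measurable M" "\<And>i. Z' i \<in> borel_measurable N"
    and B[measurable]: "\<And>i. B i \<in> sets borel"
    and eq: "\<And>a. (CLINT x|M. iexp (\<Sum>i\<in>I. a i * Z i x)) = (CLINT x|N. iexp (\<Sum>i\<in>I. a i * Z' i x))"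
  shows "(CLINT x|M. (\<Prod>i\<in>J. indicator (B i) (Z i x)) *\<^sub>R iexp (\<Sum>i\<in>I. a i * Z i x))
    = (CLINT x|N. (\<Prod>i\<in>J. indicator (B i) (Z' i x)) *\<^sub>R iexp (\<Sum>i\<in>I. a i * Z' i x))"
proof -
  interpret M: prob_space M by fact
  interpret N: prob_space N by fact
  have "finite J" using assms finite_subset by blast
  from this \<open>J \<subseteq> I\<close> show ?thesis
  proof (induction J arbitrary: a rule: finite_induct)
    case empty
    then show ?case using eq by simp
  next
    case (insert k J)
    define f where "f x = (\<Prod>i\<in>J. indicator (B i) (Z i x) :: real)" for x
    define f' where "f' x = (\<Prod>i\<in>J. indicator (B i) (Z' i x) :: real)" for x
    define s where "s b x = (\<Sum>i\<in>I. b i * Z i x)" for b x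
    define s' where "s' b x = (\<Sum>i\<in>I. b i * Z' i x)" for b x
    have [measurable]: "f \<in> borel_measurable M" "f' \<in> borel_measurable N"
      "s b \<in> borel_measurable M" "s' b \<in> borel_measurable N" for b
      unfolding f_def f'_def s_def s'_def by measurable
    have f: "0 \<le> f x" "f x \<le> 1" "0 \<le> f' y" "f' y \<le> 1" for x y
      by (auto simp: f_def f'_def intro!: prod_nonneg prod_le_1)
    have IH: "(CLINT x|M. f x *\<^sub>R iexp (s b x)) = (CLINT x|N. f' x *\<^sub>R iexp (s' b x))" for b
      using insert.IH[of b] insert.prems unfolding f_def f'_def s_def s'_def by simp
    have int: "integrable M (\<lambda>x. f x *\<^sub>R iexp (s b x))" "integrable N (\<lambda>x. f' x *\<^sub>R iexp (s' b x))" for b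
      by (auto intro!: M.integrable_const_bound[of _ 1] N.integrable_const_bound[of _ 1]
          simp: f abs_of_nonneg)
    \<comment> \<open>Changing the coefficient of coordinate \<open>k\<close> by \<open>t\<close>
      absorbs \<open>iexp (t * Z k x)\<close> into a joint exponential, so that \<open>IH\<close>
      applies to each of the three terms.\<close>
    have split: "(f x * (1 + cos (s a x + \<theta>))) *\<^sub>R iexp (t * Z k x)
        = f x *\<^sub>R iexp (s (\<lambda>i. if i = k then t else 0) x)
          + (iexp \<theta> / 2) * (f x *\<^sub>R iexp (s (\<lambda>i. a i + (if i = k then t else 0)) x))
          + (iexp (- \<theta>) / 2) * (f x *\<^sub>R iexp (s (\<lambda>i. - a i + (if i = k then t else 0)) x))" for t \<theta> x
    proof -
      have k: "s (\<lambda>i. if i = k then t else 0) x = t * Z k x"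
        using insert.prems \<open>finite I\<close> by (simp add: s_def if_distrib[of "\<lambda>c. c * _"] sum.delta cong: if_cong)
      have "s (\<lambda>i. a i + (if i = k then t else 0)) x = s a x + t * Z k x"
        "s (\<lambda>i. - a i + (if i = k then t else 0)) x = - s a x + t * Z k x"
        unfolding k[symmetric] by (simp_all add: s_def algebra_simps sum.distrib sum_negf sum_subtractf)
      then show ?thesis
        unfolding k by (simp only: cos_weight_iexp)
    qed
    have split': "(f' x * (1 + cos (s' a x + \<theta>))) *\<^sub>R iexp (t * Z' k x)
        = f' x *\<^sub>R iexp (s' (\<lambda>i. if i = k then t else 0) x)
          + (iexp \<theta> / 2) * (f' x *\<^sub>R iexp (s' (\<lambda>i. a i + (if i = k then t else 0)) x))
          + (iexp (- \<theta>) / 2) * (f' x *\<^sub>R iexp (s' (\<lambda>i. - a i + (if i = k then t else 0)) x))" for t \<theta> x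
    proof -
      have k: "s' (\<lambda>i. if i = k then t else 0) x = t * Z' k x"
        using insert.prems \<open>finite I\<close> by (simp add: s'_def if_distrib[of "\<lambda>c. c * _"] sum.delta cong: if_cong)
      have "s' (\<lambda>i. a i + (if i = k then t else 0)) x = s' a x + t * Z' k x"
        "s' (\<lambda>i. - a i + (if i = k then t else 0)) x = - s' a x + t * Z' k x"
        unfolding k[symmetric] by (simp_all add: s'_def algebra_simps sum.distrib sum_negf sum_subtractf)
      then show ?thesis
        unfolding k by (simp only: cos_weight_iexp)
    qed
    have cos_pos: "0 \<le> 1 + cos u" for u :: real
      using cos_ge_minus_one[of u] by linarith
    have cosle: "f x * (1 + cos u) \<le> 2" "0 \<le> f x * (1 + cos u)"
      "f' y * (1 + cos u) \<le> 2" "0 \<le> f' y * (1 + cos u)" for x y u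
      using mult_mono[of "f x" 1 "1 + cos u" 2] mult_mono[of "f' y" 1 "1 + cos u" 2] f
        cos_le_one[of u] cos_pos[of u]
      by (auto intro!: mult_nonneg_nonneg)
    have lin3: "(CLINT x|L. g x + c * h x + d * l x) = (CLINT x|L. g x) + c * (CLINT x|L. h x) + d * (CLINT x|L. l x)"
      if "integrable L g" "integrable L h" "integrable L l" for L :: "'c measure" and g h l :: "'c \<Rightarrow> complex" and c d
      using that by simp
    have ReIm: "(CLINT x|L. complex_of_real (g x) + \<i> * complex_of_real (h x))
        = complex_of_real (\<integral>x. g x \<partial>L) + \<i> * complex_of_real (\<integral>x. h x \<partial>L)"
      if "integrable L g" "integrable L h" for L :: "'c measure" and g h
      using that by (subst Bochner_Integration.integral_add) simp_all
    have one: "(\<integral>x. f x * (1 + cos (s a x + \<theta>)) * indicator (B k) (Z k x) \<partial>M)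
        = (\<integral>x. f' x * (1 + cos (s' a x + \<theta>)) * indicator (B k) (Z' k x) \<partial>N)" for \<theta>
    proof (rule weighted_char_unique[where c = 2])
      show "(CLINT x|M. (f x * (1 + cos (s a x + \<theta>))) *\<^sub>R iexp (t * Z k x))
          = (CLINT x|N. (f' x * (1 + cos (s' a x + \<theta>))) *\<^sub>R iexp (t * Z' k x))" for t
        unfolding split split' by (simp only: lin3[OF int(1) int(1) int(1)] lin3[OF int(2) int(2) int(2)] IH)
    qed (use cosle M.finite_measure_axioms N.finite_measure_axioms in auto)
    \<comment> \<open>The constant part of the weight, which is subtracted from \<open>one\<close>
      to isolate the signed cosine.\<close>
    have zero: "(\<integral>x. f x * 2 * indicator (B k) (Z k x) \<partial>M) = (\<integral>x. f' x * 2 * indicator (B k) (Z' k x) \<partial>N)"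
    proof (rule weighted_char_unique[where c = 2])
      have k: "s (\<lambda>i. if i = k then t else 0) x = t * Z k x" "s' (\<lambda>i. if i = k then t else 0) y = t * Z' k y" for t x y
        using insert.prems \<open>finite I\<close> by (simp_all add: s_def s'_def if_distrib[of "\<lambda>c. c * _"] sum.delta cong: if_cong)
      show "(CLINT x|M. (f x * 2) *\<^sub>R iexp (t * Z k x)) = (CLINT x|N. (f' x * 2) *\<^sub>R iexp (t * Z' k x))" for t
        using IH[of "\<lambda>i. if i = k then t else 0"] unfolding k
        by (simp add: mult.commute[of _ 2] scaleR_scaleR[symmetric] del: scaleR_scaleR)
    qed (use f M.finite_measure_axioms N.finite_measure_axioms in auto)
    have ib: "integrable M (\<lambda>x. f x * g x * indicator (B k) (Z k x))"
      if [measurable]: "g \<in> borel_measurable M" and "\<And>x. \<bar>g x\<bar> \<le> 1" for g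
      using that f by (intro M.integrable_const_bound[of _ 1])
        (auto simp: abs_mult indicator_def intro!: mult_le_one)
    have ib': "integrable N (\<lambda>x. f' x * g x * indicator (B k) (Z' k x))"
      if [measurable]: "g \<in> borel_measurable N" and "\<And>x. \<bar>g x\<bar> \<le> 1" for g
      using that f by (intro N.integrable_const_bound[of _ 1])
        (auto simp: abs_mult indicator_def intro!: mult_le_one)
    have cos: "(\<integral>x. f x * cos (s a x + \<theta>) * indicator (B k) (Z k x) \<partial>M)
        = (\<integral>x. f' x * cos (s' a x + \<theta>) * indicator (B k) (Z' k x) \<partial>N)" for \<theta>
    proof -
      have "(\<integral>x. f x * 1 * indicator (B k) (Z k x) + f x * cos (s a x + \<theta>) * indicator (B k) (Z k x) \<partial>M)
          = (\<integral>x. f' x * 1 * indicator (B k) (Z' k x) + f' x * cos (s' a x + \<theta>) * indicator (B k) (Z' k x) \<partial>N)"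
        using one[of \<theta>] by (simp add: algebra_simps)
      moreover have "(\<integral>x. f x * 1 * indicator (B k) (Z k x) \<partial>M) = (\<integral>x. f' x * 1 * indicator (B k) (Z' k x) \<partial>N)"
        using zero by (simp add: mult.commute[of _ 2] mult.assoc)
      ultimately show ?thesis
        using ib[of "\<lambda>_. 1"] ib'[of "\<lambda>_. 1"] ib[of "\<lambda>x. cos (s a x + \<theta>)"] ib'[of "\<lambda>x. cos (s' a x + \<theta>)"]
        by (simp add: Bochner_Integration.integral_add)
    qed
    \<comment> \<open>The phases 0 and \<open>- pi / 2\<close> give the cosine and the sine, the
      real and imaginary parts of the exponential.\<close>
    have main: "(CLINT x|M. (\<Prod>i\<in>insert k J. indicator (B i) (Z i x)) *\<^sub>R iexp (s a x))
        = complex_of_real (\<integral>x. f x * cos (s a x + 0) * indicator (B k) (Z k x) \<partial>M)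
          + \<i> * complex_of_real (\<integral>x. f x * cos (s a x + (- pi / 2)) * indicator (B k) (Z k x) \<partial>M)"
    proof -
      have "(\<Prod>i\<in>insert k J. indicator (B i) (Z i x)) *\<^sub>R iexp (s a x)
         = complex_of_real (f x * cos (s a x + 0) * indicator (B k) (Z k x))
          + \<i> * complex_of_real (f x * cos (s a x + (- pi / 2)) * indicator (B k) (Z k x))" for x
      proof -
        have "(\<Prod>i\<in>insert k J. indicator (B i) (Z i x)) = indicator (B k) (Z k x) * f x"
          using insert.hyps by (simp add: f_def)
        then show ?thesis by (simp add: complex_eq_iff Re_exp Im_exp cos_diff)
      qed
      then show ?thesis
        by (simp only:) (intro ReIm ib; simp)
    qed
    have main': "(CLINT x|N. (\<Prod>i\<in>insert k J. indicator (B i) (Z' i x)) *\<^sub>R iexp (s' a x))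
        = complex_of_real (\<integral>x. f' x * cos (s' a x + 0) * indicator (B k) (Z' k x) \<partial>N)
          + \<i> * complex_of_real (\<integral>x. f' x * cos (s' a x + (- pi / 2)) * indicator (B k) (Z' k x) \<partial>N)"
    proof -
      have "(\<Prod>i\<in>insert k J. indicator (B i) (Z' i x)) *\<^sub>R iexp (s' a x)
         = complex_of_real (f' x * cos (s' a x + 0) * indicator (B k) (Z' k x))
          + \<i> * complex_of_real (f' x * cos (s' a x + (- pi / 2)) * indicator (B k) (Z' k x))" for x
      proof -
        have "(\<Prod>i\<in>insert k J. indicator (B i) (Z' i x)) = indicator (B k) (Z' k x) * f' x"
          using insert.hyps by (simp add: f'_def)
        then show ?thesis by (simp add: complex_eq_iff Re_exp Im_exp cos_diff)
      qed
      then show ?thesis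
        by (simp only:) (intro ReIm ib'; simp)
    qed
    have "(CLINT x|M. (\<Prod>i\<in>insert k J. indicator (B i) (Z i x)) *\<^sub>R iexp (s a x))
        = (CLINT x|N. (\<Prod>i\<in>insert k J. indicator (B i) (Z' i x)) *\<^sub>R iexp (s' a x))"
      by (simp only: main main' cos)
    then show ?case by (simp only: s_def s'_def)
  qed
qed

text \<open>The previous lemma with \<open>J = I\<close> and zero coefficients: the exponential is 1
  and the product of indicators is the indicator of the event.\<close>

lemma joint_char_unique:
  fixes Z :: "'i \<Rightarrow> 'a \<Rightarrow> real" and Z' :: "'i \<Rightarrow> 'b \<Rightarrow> real"
  assumes "prob_space M" "prob_space N" "finite I"
    and Z[measurable]: "\<And>i. Z i \<in> borel_measurable M" "\<And>i. Z' i \<in> borel_measurable N"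
    and B[measurable]: "\<And>i. B i \<in> sets borel"
    and eq: "\<And>a. (CLINT x|M. iexp (\<Sum>i\<in>I. a i * Z i x)) = (CLINT x|N. iexp (\<Sum>i\<in>I. a i * Z' i x))"
  shows "measure M {x\<in>space M. \<forall>i\<in>I. Z i x \<in> B i} = measure N {x\<in>space N. \<forall>i\<in>I. Z' i x \<in> B i}"
proof -
  have aux: "complex_of_real (measure L {x\<in>space L. \<forall>i\<in>I. Y i x \<in> B i})
      = (CLINT x|L. (\<Prod>i\<in>I. indicator (B i) (Y i x)) *\<^sub>R iexp (\<Sum>i\<in>I. 0 * Y i x))"
    if "prob_space L" and [measurable]: "\<And>i. Y i \<in> borel_measurable L"
    for L :: "'c measure" and Y :: "'i \<Rightarrow> 'c \<Rightarrow> real"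
  proof -
    interpret prob_space L by fact
    have "complex_of_real (measure L {x\<in>space L. \<forall>i\<in>I. Y i x \<in> B i})
        = (\<integral>x. complex_of_real (indicator {x\<in>space L. \<forall>i\<in>I. Y i x \<in> B i} x) \<partial>L)"
      using \<open>finite I\<close> by simp
    also have "\<dots> = (CLINT x|L. (\<Prod>i\<in>I. indicator (B i) (Y i x)) *\<^sub>R iexp (\<Sum>i\<in>I. 0 * Y i x))"
    proof (rule Bochner_Integration.integral_cong[OF refl])
      fix x assume "x \<in> space L"
      then have "(\<Prod>i\<in>I. indicator (B i) (Y i x)) = (indicator {x\<in>space L. \<forall>i\<in>I. Y i x \<in> B i} x :: real)"
        using \<open>finite I\<close> by (auto simp: indicator_def prod_zero_iff)
      then show "complex_of_real (indicator {x\<in>space L. \<forall>i\<in>I. Y i x \<in> B i} x)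
          = (\<Prod>i\<in>I. indicator (B i) (Y i x)) *\<^sub>R iexp (\<Sum>i\<in>I. 0 * Y i x)"
        by (simp add: scaleR_conv_of_real)
    qed
    finally show ?thesis .
  qed
  have "complex_of_real (measure M {x\<in>space M. \<forall>i\<in>I. Z i x \<in> B i})
      = complex_of_real (measure N {x\<in>space N. \<forall>i\<in>I. Z' i x \<in> B i})"
    unfolding aux[OF assms(1) Z(1)] aux[OF assms(2) Z(2)]
    by (rule joint_char_unique_aux[OF assms(1-3) subset_refl Z B eq])
  then show ?thesis by (simp only: of_real_eq_iff)
qed

section \<open>Gaussian shifts and Laplace transforms\<close>

lemma std_normal_density_shift:
  "std_normal_density (x + s) = std_normal_density x * exp (- s * x - s\<^sup>2 / 2)"
  by (simp add: std_normal_density_def exp_add[symmetric] power2_eq_square field_simps)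

text \<open>Completing the square: the weighted density is \<open>exp (c\<^sup>2 / 2)\<close> times
  the normal density centred at \<open>c\<close>.\<close>

lemma integrable_std_normal_exp: "integrable std_normal_distribution (\<lambda>x. exp (c * x))"
proof -
  have "integrable lborel (\<lambda>x. std_normal_density (x + (- c)))"
    using lborel_integrable_real_affine[of std_normal_density 1 "- c"]
    by (simp add: add.commute)
  then have "integrable lborel (\<lambda>x. exp (c\<^sup>2 / 2) * std_normal_density (x + (- c)))"
    by (rule integrable_mult_right)
  moreover have "exp (c\<^sup>2 / 2) * std_normal_density (x + (- c)) = std_normal_density x * exp (c * x)" for x
    by (subst std_normal_density_shift) (simp add: exp_add[symmetric] exp_diff field_simps)
  ultimately have "integrable lborel (\<lambda>x. std_normal_density x * exp (c * x))"
    by (simp only:)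
  then show ?thesis
    by (subst integrable_density) simp_all
qed

text \<open>The one-dimensional Cameron-Martin formula, by translation invariance of Lebesgue
  measure.\<close>

lemma integral_std_normal_shift:
  fixes f :: "real \<Rightarrow> real"
  assumes [measurable]: "f \<in> borel_measurable borel"
  shows "(\<integral>x. f (x - s) \<partial>std_normal_distribution)
    = (\<integral>x. f x * exp (- s * x - s\<^sup>2 / 2) \<partial>std_normal_distribution)"
proof -
  have "(\<integral>x. f (x - s) \<partial>std_normal_distribution) = (\<integral>x. std_normal_density x * f (x - s) \<partial>lborel)"
    by (subst integral_density) simp_all
  also have "\<dots> = (\<integral>x. std_normal_density (x + s) * f x \<partial>lborel)"
    by (subst lborel_integral_real_affine[of 1 _ s]) (simp_all add: add.commute)
  also have "\<dots> = (\<integral>x. std_normal_density x * (f x * exp (- s * x - s\<^sup>2 / 2)) \<partial>lborel)"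
    by (subst std_normal_density_shift) (simp add: ac_simps)
  also have "\<dots> = (\<integral>x. f x * exp (- s * x - s\<^sup>2 / 2) \<partial>std_normal_distribution)"
    by (subst integral_density) simp_all
  finally show ?thesis .
qed

text \<open>Expanding the exponential under the integral gives a power series converging in the
  whole plane. Sum and integral may be exchanged because
  \<open>exp (norm w * \<bar>Y x\<bar>)\<close> is integrable, being at most the sum of the
  exponentials with both signs.\<close>

lemma holomorphic_laplace:
  fixes Y f :: "'a \<Rightarrow> real"
  assumes [measurable]: "Y \<in> borel_measurable N" "f \<in> borel_measurable N"
    and f: "\<And>x. \<bar>f x\<bar> \<le> 1"
    and int: "\<And>c. integrable N (\<lambda>x. exp (c * Y x))"
  shows "(\<lambda>z. CLINT x|N. f x *\<^sub>R exp (z * Y x)) holomorphic_on UNIV"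
proof -
  define a where "a n = (CLINT x|N. complex_of_real (f x * Y x ^ n / fact n))" for n
  have sums: "(\<lambda>n. a n * w ^ n) sums (CLINT x|N. f x *\<^sub>R exp (w * Y x))" for w
  proof -
    define g where "g n x = complex_of_real (f x * Y x ^ n / fact n) * w ^ n" for n x
    have [measurable]: "g n \<in> borel_measurable N" for n
      unfolding g_def by measurable
    have expint: "integrable N (\<lambda>x. exp (norm w * \<bar>Y x\<bar>))"
    proof (rule Bochner_Integration.integrable_bound)
      show "integrable N (\<lambda>x. exp (norm w * Y x) + exp (- norm w * Y x))"
        by (intro Bochner_Integration.integrable_add int)
      show "AE x in N. norm (exp (norm w * \<bar>Y x\<bar>)) \<le> norm (exp (norm w * Y x) + exp (- norm w * Y x))"
      proof (rule AE_I2)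
        fix x
        have "exp (norm w * \<bar>Y x\<bar>) \<le> exp (norm w * Y x) + exp (- norm w * Y x)"
          by (simp add: abs_if)
        then show "norm (exp (norm w * \<bar>Y x\<bar>)) \<le> norm (exp (norm w * Y x) + exp (- norm w * Y x))"
          by simp
      qed
    qed simp
    have gle: "norm (g n x) \<le> (norm w * \<bar>Y x\<bar>) ^ n / fact n" for n x
      using mult_right_mono[OF f[of x], of "(norm w * \<bar>Y x\<bar>) ^ n / fact n"]
      by (simp add: g_def norm_mult norm_power norm_divide power_abs power_mult_distrib ac_simps)
    have es: "(\<lambda>n. (norm w * \<bar>Y x\<bar>) ^ n / fact n) sums exp (norm w * \<bar>Y x\<bar>)" for x
      using exp_converges[of "norm w * \<bar>Y x\<bar>"] by (simp add: divide_inverse mult.commute)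
    have gsum: "summable (\<lambda>n. norm (g n x))" for x
      by (rule summable_comparison_test'[OF sums_summable[OF es[of x]]]) (simp add: gle)
    have part: "(\<Sum>i<n. norm (g i x)) \<le> exp (norm w * \<bar>Y x\<bar>)" for n x
    proof -
      have "(\<Sum>i<n. norm (g i x)) \<le> (\<Sum>i<n. (norm w * \<bar>Y x\<bar>) ^ i / fact i)"
        by (intro sum_mono gle)
      also have "\<dots> \<le> (\<Sum>i. (norm w * \<bar>Y x\<bar>) ^ i / fact i)"
        by (intro sum_le_suminf sums_summable[OF es]) auto
      finally show ?thesis using es[of x] by (simp add: sums_iff)
    qed
    have gint: "integrable N (g n)" for n
    proof (rule Bochner_Integration.integrable_bound[OF expint])
      have "norm (g n x) \<le> exp (norm w * \<bar>Y x\<bar>)" for x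
        using part[where n = "Suc n" and x = x] sum_nonneg[of "{..<n}" "\<lambda>i. norm (g i x)"] by simp
      then show "AE x in N. norm (g n x) \<le> norm (exp (norm w * \<bar>Y x\<bar>))" by simp
    qed simp
    have "summable (\<lambda>n. \<integral>x. norm (g n x) \<partial>N)"
    proof (rule bounded_imp_summable)
      fix n
      have "(\<Sum>i\<le>n. \<integral>x. norm (g i x) \<partial>N) = (\<integral>x. (\<Sum>i<Suc n. norm (g i x)) \<partial>N)"
        using gint by (simp add: lessThan_Suc_atMost del: sum.lessThan_Suc)
      also have "\<dots> \<le> (\<integral>x. exp (norm w * \<bar>Y x\<bar>) \<partial>N)"
        using gint by (intro integral_mono expint part) simp
      finally show "(\<Sum>i\<le>n. \<integral>x. norm (g i x) \<partial>N) \<le> (\<integral>x. exp (norm w * \<bar>Y x\<bar>) \<partial>N)" .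
    qed simp
    then have "(\<lambda>n. CLINT x|N. g n x) sums (CLINT x|N. (\<Sum>n. g n x))"
      by (intro sums_integral gint) (simp_all add: gsum)
    moreover have "(CLINT x|N. g n x) = a n * w ^ n" for n
      unfolding g_def a_def by (rule integral_mult_left_zero)
    moreover have "(\<Sum>n. g n x) = f x *\<^sub>R exp (w * Y x)" for x
    proof -
      have "(\<lambda>n. f x *\<^sub>R ((w * Y x) ^ n /\<^sub>R fact n)) sums (f x *\<^sub>R exp (w * Y x))"
        by (intro sums_scaleR_right exp_converges)
      moreover have "f x *\<^sub>R ((w * Y x) ^ n /\<^sub>R fact n) = g n x" for n
        by (simp add: g_def scaleR_conv_of_real power_mult_distrib field_simps)
      ultimately show ?thesis by (simp add: sums_iff)
    qed
    ultimately show ?thesis by simp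
  qed
  have "(\<lambda>z. CLINT x|N. f x *\<^sub>R exp (z * Y x)) holomorphic_on ball 0 r" for r
    by (rule power_series_holomorphic[where a = a]) (use sums in simp)
  then have "(\<lambda>z. CLINT x|N. f x *\<^sub>R exp (z * Y x)) field_differentiable at z" for z
    by (rule holomorphic_on_imp_differentiable_at[of _ "ball 0 (norm z + 1)"]) auto
  then show ?thesis
    by (simp add: holomorphic_on_def)
qed

section \<open>Level sets of the Gaussian free field\<close>

lemma gff_iexp:
  assumes "is_gff E M \<phi>" "finite K"
  shows "(CLINT \<omega>|M. iexp (\<Sum>x\<in>K. a x * \<phi> x \<omega>))
    = exp (- complex_of_real ((\<Sum>x\<in>K. \<Sum>y\<in>K. a x * a y * green E x y) / 2))"
proof -
  have [measurable]: "\<phi> x \<in> borel_measurable M" for x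
    using assms by (simp add: is_gff_def)
  have "char (distr M borel (\<lambda>\<omega>. \<Sum>x\<in>K. a x * \<phi> x \<omega>)) 1
      = exp (- complex_of_real (1\<^sup>2 * (\<Sum>x\<in>K. \<Sum>y\<in>K. a x * a y * green E x y) / 2))"
    using assms unfolding is_gff_def by blast
  then show ?thesis
    by (simp add: char_def integral_distr)
qed

context transient_graph
begin

text \<open>Pythagoras: \<open>c\<close> is the residual of \<open>a\<close> after regression on
  \<open>Y = \<Sum>x\<in>K. equi K x * \<phi> x\<close>. As the equilibrium potential is 1 on
  \<open>K\<close>, the covariance with \<open>Y\<close> is \<open>sum a K\<close> and the variance
  of \<open>Y\<close> is \<open>cap E K\<close>.\<close>

lemma variance_orthogonal:
  fixes a :: "'v \<Rightarrow> real"
  assumes K: "finite K" "K \<noteq> {}"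
  defines "c \<equiv> (\<lambda>x. a x - sum a K / cap E K * equi K x)"
  shows "(\<Sum>x\<in>K. \<Sum>y\<in>K. c x * c y * green E x y)
    = (\<Sum>x\<in>K. \<Sum>y\<in>K. a x * a y * green E x y) - (sum a K)\<^sup>2 / cap E K"
proof -
  define s where "s = sum a K / cap E K"
  have Q: "(\<Sum>x\<in>K. \<Sum>y\<in>K. b x * equi K y * green E x y) = sum b K" for b
  proof -
    have "(\<Sum>x\<in>K. \<Sum>y\<in>K. b x * equi K y * green E x y)
        = (\<Sum>x\<in>K. b x * (\<Sum>y\<in>K. green E x y * equi K y))"
      by (simp add: sum_distrib_left ac_simps)
    then show ?thesis using K by (simp add: equilibrium_potential)
  qed
  have Q': "(\<Sum>x\<in>K. \<Sum>y\<in>K. equi K x * b y * green E x y) = sum b K" for b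
  proof -
    have "(\<Sum>x\<in>K. \<Sum>y\<in>K. equi K x * b y * green E x y)
        = (\<Sum>y\<in>K. \<Sum>x\<in>K. b y * equi K x * green E y x)"
      by (subst sum.swap) (simp add: green_sym ac_simps)
    then show ?thesis by (simp add: Q)
  qed
  have "c x * c y * green E x y = a x * a y * green E x y - s * (a x * equi K y * green E x y)
      - s * (equi K x * a y * green E x y) + s\<^sup>2 * (equi K x * equi K y * green E x y)" for x y
    by (simp add: c_def s_def[symmetric] algebra_simps power2_eq_square)
  then have "(\<Sum>x\<in>K. \<Sum>y\<in>K. c x * c y * green E x y)
      = (\<Sum>x\<in>K. \<Sum>y\<in>K. a x * a y * green E x y) - s * sum a K - s * sum a K + s\<^sup>2 * cap E K"
    by (simp add: sum.distrib sum_subtractf sum_distrib_left[symmetric] Q Q' cap_eq)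
  also have "\<dots> = (\<Sum>x\<in>K. \<Sum>y\<in>K. a x * a y * green E x y) - (sum a K)\<^sup>2 / cap E K"
    using cap_pos[OF K] by (simp add: s_def field_simps power2_eq_square)
  finally show ?thesis .
qed

text \<open>On \<open>K\<close> the field is the sum of a field independent of \<open>Y = \<Sum>x\<in>K. equi K x * \<phi> x\<close> and of the
  constant \<open>Y / cap E K\<close>, because \<open>Y\<close> has covariance 1 with each \<open>\<phi> x\<close>.  Resampling \<open>Y\<close> by an
  independent Gaussian thus preserves the law and turns a change of level into a shift of one
  Gaussian variable.\<close>

lemma level_event_laplace:
  fixes M :: "'w measure" and \<phi> :: "'v \<Rightarrow> 'w \<Rightarrow> real"
  assumes gff: "is_gff E M \<phi>" and K: "finite K" "K \<noteq> {}"
    and interior: "\<And>x. x \<in> S \<Longrightarrow> nbrs E x \<subseteq> K"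
  obtains N :: "('w \<times> real) measure" and Y f where
    "Y \<in> borel_measurable N" "f \<in> borel_measurable N" "\<And>p. 0 \<le> f p" "\<And>p. f p \<le> 1"
    "\<And>p. f p \<noteq> 0 \<Longrightarrow> Y p \<le> 0" "\<And>c. integrable N (\<lambda>p. exp (c * Y p))"
    "\<And>h. measure M {\<omega>\<in>space M. \<forall>x\<in>K. \<phi> x \<omega> \<in> (if x \<in> S then {h..} else {..<h})}
      = (\<integral>p. f p * exp (- h * Y p - h\<^sup>2 * cap E K / 2) \<partial>N)"
proof -
  interpret M: prob_space M using gff by (simp add: is_gff_def)
  interpret G: prob_space std_normal_distribution
    using real_dist_normal_dist by (rule real_distribution.axioms(1))
  interpret P: pair_prob_space M std_normal_distribution ..
  have [measurable]: "\<phi> x \<in> borel_measurable M" for x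
    using gff by (simp add: is_gff_def)
  define \<sigma> where "\<sigma> = sqrt (cap E K)"
  have \<sigma>: "0 < \<sigma>" "\<sigma>\<^sup>2 = cap E K" using cap_pos[OF K] by (auto simp: \<sigma>_def)
  define N where "N = M \<Otimes>\<^sub>M std_normal_distribution"
  interpret N: prob_space N unfolding N_def by (rule P.prob_space_axioms)
  define \<psi> where "\<psi> x \<omega> = \<phi> x \<omega> - (\<Sum>y\<in>K. equi K y * \<phi> y \<omega>) / cap E K" for x \<omega>
  have [measurable]: "\<psi> x \<in> borel_measurable M" for x
    unfolding \<psi>_def by measurable
  \<comment> \<open>\<open>snd p / \<sigma>\<close> has variance \<open>1 / cap E K\<close>, the
    same as the removed average \<open>Y / cap E K\<close>.\<close>
  define \<phi>' where "\<phi>' x p = \<psi> x (fst p) + snd p / \<sigma>" for x p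
  have \<phi>'_meas[measurable]: "\<phi>' x \<in> borel_measurable N" for x
    unfolding \<phi>'_def N_def by measurable
  define B where "B h x = (if x \<in> S then {h..} else {..<h::real})" for h x
  have B_meas[measurable]: "B h x \<in> sets borel" for h x
    by (simp add: B_def)
  define f where "f p = (\<Prod>x\<in>K. indicator (B 0 x) (\<phi>' x p) :: real)" for p
  have [measurable]: "f \<in> borel_measurable N"
    unfolding f_def by measurable
  have f01: "0 \<le> f p" "f p \<le> 1" for p
    by (auto simp: f_def intro!: prod_nonneg prod_le_1)
  \<comment> \<open>The equilibrium average of the resampled field, as the computation in
    \<open>neg\<close> confirms.\<close>
  define Y where "Y p = \<sigma> * snd p" for p :: "'w \<times> real"
  have [measurable]: "Y \<in> borel_measurable N"
    unfolding Y_def N_def by measurable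

  have neg: "Y p \<le> 0" if "f p \<noteq> 0" for p
  proof -
    have in_B: "\<phi>' x p \<in> B 0 x" if "x \<in> K" for x
      using \<open>f p \<noteq> 0\<close> that K by (auto simp: f_def indicator_def split: if_splits)
    have "(\<Sum>x\<in>K. equi K x * \<phi>' x p) = (\<Sum>x\<in>K. equi K x * \<phi> x (fst p))
        - (\<Sum>x\<in>K. equi K x) * ((\<Sum>y\<in>K. equi K y * \<phi> y (fst p)) / cap E K)
        + (\<Sum>x\<in>K. equi K x) * (snd p / \<sigma>)"
      unfolding sum_distrib_right sum.distrib[symmetric] sum_subtractf[symmetric]
      by (intro sum.cong refl) (simp add: \<phi>'_def \<psi>_def algebra_simps)
    also have "\<dots> = \<sigma> * snd p"
      using \<sigma> cap_pos[OF K] unfolding cap_eq[symmetric]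
      by (simp add: \<sigma>(2)[symmetric] power2_eq_square)
    finally have "Y p = (\<Sum>x\<in>K. equi K x * \<phi>' x p)" by (simp add: Y_def)
    also have "\<dots> \<le> 0"
    proof (rule sum_nonpos)
      fix x assume "x \<in> K"
      show "equi K x * \<phi>' x p \<le> 0"
      proof (cases "x \<in> S")
        case True
        then show ?thesis using interior by (simp add: equi_interior)
      next
        case False
        then show ?thesis
          using in_B[OF \<open>x \<in> K\<close>] equi_nonneg[of K x] by (simp add: B_def mult_nonneg_nonpos)
      qed
    qed
    finally show ?thesis .
  qed

  have exp_snd: "integrable N (\<lambda>p. exp (c * snd p))" for c
    unfolding N_def
  proof (rule P.Fubini_integrable)
    show "AE x in M. integrable std_normal_distribution (\<lambda>y. exp (c * snd (x, y)))"
      by (simp add: integrable_std_normal_exp)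
  qed (simp_all)
  have exp_Y: "integrable N (\<lambda>p. exp (c * Y p))" for c
    using exp_snd[of "c * \<sigma>"] by (simp add: Y_def mult.assoc)

  \<comment> \<open>The variance lost in passing to \<open>c\<close> is
    \<open>(sum a K)\<^sup>2 / cap E K\<close>, exactly what the independent Gaussian
    restores.\<close>
  have char_eq: "(CLINT p|M. iexp (\<Sum>x\<in>K. a x * \<phi> x p)) = (CLINT p|N. iexp (\<Sum>x\<in>K. a x * \<phi>' x p))" for a
  proof -
    define c where "c x = a x - sum a K / cap E K * equi K x" for x
    have lin: "(\<Sum>x\<in>K. a x * \<phi>' x p) = (\<Sum>x\<in>K. c x * \<phi> x (fst p)) + sum a K / \<sigma> * snd p" for p
    proof -
      have "(\<Sum>x\<in>K. a x * \<phi>' x p) = (\<Sum>x\<in>K. a x * \<phi> x (fst p))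
          - sum a K * ((\<Sum>y\<in>K. equi K y * \<phi> y (fst p)) / cap E K) + sum a K * (snd p / \<sigma>)"
        unfolding sum_distrib_right sum.distrib[symmetric] sum_subtractf[symmetric]
        by (intro sum.cong refl) (simp add: \<phi>'_def \<psi>_def algebra_simps)
      moreover have "(\<Sum>x\<in>K. c x * \<phi> x (fst p)) = (\<Sum>x\<in>K. a x * \<phi> x (fst p))
          - sum a K / cap E K * (\<Sum>y\<in>K. equi K y * \<phi> y (fst p))"
        by (simp add: c_def sum_distrib_left sum_subtractf algebra_simps)
      ultimately show ?thesis by simp
    qed
    have "(CLINT p|N. iexp (\<Sum>x\<in>K. a x * \<phi>' x p))
        = (CLINT \<omega>|M. CLINT g|std_normal_distribution. iexp (\<Sum>x\<in>K. a x * \<phi>' x (\<omega>, g)))"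
      unfolding N_def
      by (rule P.integral_fst'[symmetric])
        (auto intro!: N.integrable_iexp simp: N_def[symmetric] simp del: of_real_sum)
    also have "\<dots> = (CLINT \<omega>|M. CLINT g|std_normal_distribution.
        iexp (\<Sum>x\<in>K. c x * \<phi> x \<omega>) * iexp (sum a K / \<sigma> * g))"
      unfolding lin by (simp only: of_real_add distrib_left exp_add fst_conv snd_conv)
    also have "\<dots> = (CLINT \<omega>|M. iexp (\<Sum>x\<in>K. c x * \<phi> x \<omega>)) * char std_normal_distribution (sum a K / \<sigma>)"
      by (simp only: char_def integral_mult_right_zero integral_mult_left_zero)
    also have "\<dots> = exp (- complex_of_real ((\<Sum>x\<in>K. \<Sum>y\<in>K. c x * c y * green E x y) / 2))
        * complex_of_real (exp (- (sum a K / \<sigma>)\<^sup>2 / 2))"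
      by (simp only: gff_iexp[OF gff K(1)] char_std_normal_distribution)
    also have "\<dots> = complex_of_real (exp (- (\<Sum>x\<in>K. \<Sum>y\<in>K. c x * c y * green E x y) / 2)
        * exp (- (sum a K / \<sigma>)\<^sup>2 / 2))"
      by (simp only: of_real_mult exp_of_real[symmetric] of_real_minus[symmetric] minus_divide_left)
    also have "\<dots> = complex_of_real (exp (- (\<Sum>x\<in>K. \<Sum>y\<in>K. a x * a y * green E x y) / 2))"
      unfolding exp_add[symmetric] c_def variance_orthogonal[OF K]
      by (simp add: power_divide \<sigma> field_simps)
    also have "\<dots> = (CLINT \<omega>|M. iexp (\<Sum>x\<in>K. a x * \<phi> x \<omega>))"
      by (simp only: gff_iexp[OF gff K(1)] exp_of_real[symmetric] of_real_minus[symmetric] minus_divide_left)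
    finally show ?thesis by simp
  qed

  have prob: "measure M {\<omega>\<in>space M. \<forall>x\<in>K. \<phi> x \<omega> \<in> B h x}
      = (\<integral>p. f p * exp (- h * Y p - h\<^sup>2 * cap E K / 2) \<partial>N)" for h
  proof -
    \<comment> \<open>Lowering the Gaussian coordinate by \<open>h * \<sigma>\<close> lowers
      \<open>\<phi>'\<close> by \<open>h\<close> at every site, which moves level \<open>h\<close>
      to level 0.\<close>
    have shift: "indicator (B h x) (\<phi>' x (\<omega>, g)) = (indicator (B 0 x) (\<phi>' x (\<omega>, g - h * \<sigma>)) :: real)" for x \<omega> g
      using \<sigma> by (auto simp: B_def \<phi>'_def indicator_def field_simps)
    have "measure M {\<omega>\<in>space M. \<forall>x\<in>K. \<phi> x \<omega> \<in> B h x} = measure N {p\<in>space N. \<forall>x\<in>K. \<phi>' x p \<in> B h x}"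
      using char_eq by (intro joint_char_unique K M.prob_space_axioms N.prob_space_axioms) simp_all
    also have "\<dots> = (\<integral>p. indicator {p\<in>space N. \<forall>x\<in>K. \<phi>' x p \<in> B h x} p \<partial>N)"
      using K by simp
    also have "\<dots> = (\<integral>p. (\<Prod>x\<in>K. indicator (B h x) (\<phi>' x p)) \<partial>N)"
      using K by (intro Bochner_Integration.integral_cong) (auto simp: indicator_def prod_zero_iff)
    also have "\<dots> = (\<integral>\<omega>. (\<integral>g. (\<Prod>x\<in>K. indicator (B h x) (\<phi>' x (\<omega>, g))) \<partial>std_normal_distribution) \<partial>M)"
      unfolding N_def
      by (rule P.integral_fst'[symmetric], fold N_def, rule N.integrable_const_bound[of _ 1])
        (auto intro!: prod_le_1 simp: prod_nonneg)
    also have "\<dots> = (\<integral>\<omega>. (\<integral>g. f (\<omega>, g - h * \<sigma>) \<partial>std_normal_distribution) \<partial>M)"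
      unfolding shift f_def ..
    also have "\<dots> = (\<integral>\<omega>. (\<integral>g. f (\<omega>, g) * exp (- (h * \<sigma>) * g - (h * \<sigma>)\<^sup>2 / 2) \<partial>std_normal_distribution) \<partial>M)"
    proof (rule Bochner_Integration.integral_cong[OF refl])
      fix \<omega> assume "\<omega> \<in> space M"
      have "(\<lambda>g. f (\<omega>, g)) \<in> borel_measurable borel"
        unfolding f_def \<phi>'_def fst_conv snd_conv by measurable
      then show "(\<integral>g. f (\<omega>, g - h * \<sigma>) \<partial>std_normal_distribution)
          = (\<integral>g. f (\<omega>, g) * exp (- (h * \<sigma>) * g - (h * \<sigma>)\<^sup>2 / 2) \<partial>std_normal_distribution)"
        by (rule integral_std_normal_shift)
    qed
    also have "\<dots> = (\<integral>\<omega>. (\<integral>g. f (\<omega>, g) * exp (- h * Y (\<omega>, g) - h\<^sup>2 * cap E K / 2) \<partial>std_normal_distribution) \<partial>M)"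
      by (simp add: Y_def \<sigma>(2)[symmetric] power_mult_distrib mult.assoc)
    also have "\<dots> = (\<integral>p. f p * exp (- h * Y p - h\<^sup>2 * cap E K / 2) \<partial>N)"
      unfolding N_def
    proof (rule P.integral_fst', fold N_def, rule Bochner_Integration.integrable_bound)
      show "integrable N (\<lambda>p. exp (- h * Y p) * exp (- (h\<^sup>2 * cap E K / 2)))"
        by (intro integrable_mult_left exp_Y)
      show "AE p in N. norm (f p * exp (- h * Y p - h\<^sup>2 * cap E K / 2))
          \<le> norm (exp (- h * Y p) * exp (- (h\<^sup>2 * cap E K / 2)))"
        using f01 by (auto simp: exp_add[symmetric] abs_mult intro!: mult_left_le_one_le)
    qed simp
    finally show ?thesis .
  qed
  show thesis
    by (rule that[of Y N f]) (use f01 neg exp_Y prob in \<open>simp_all add: B_def\<close>)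
qed

text \<open>The Laplace formula makes sense for complex \<open>z\<close>. Since
  \<open>Y \<le> 0\<close> where \<open>f\<close> is nonzero, \<open>exp (- z * Y)\<close> has
  modulus at most 1 there when \<open>Re z \<le> 0\<close>; the Gaussian factor has the stated
  modulus because the real part of \<open>z\<^sup>2\<close> is
  \<open>(Re z)\<^sup>2 - (Im z)\<^sup>2\<close>.\<close>

lemma level_event_entire:
  fixes M :: "'w measure" and \<phi> :: "'v \<Rightarrow> 'w \<Rightarrow> real"
  assumes gff: "is_gff E M \<phi>" and K: "finite K" "K \<noteq> {}"
    and interior: "\<And>x. x \<in> S \<Longrightarrow> nbrs E x \<subseteq> K"
  defines "p \<equiv> \<lambda>h. measure M {\<omega>\<in>space M. \<forall>x\<in>K. \<phi> x \<omega> \<in> (if x \<in> S then {h..} else {..<h})}"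
  obtains G where "G holomorphic_on UNIV" "\<And>h. G (complex_of_real h) = complex_of_real (p h)"
    "\<And>z. Re z \<le> 0 \<Longrightarrow> norm (G z) \<le> exp (- ((Re z)\<^sup>2 - (Im z)\<^sup>2) / 2 * cap E K) * p 0"
proof -
  obtain N :: "('w \<times> real) measure" and Y f where
    [measurable]: "Y \<in> borel_measurable N" "f \<in> borel_measurable N"
    and f: "\<And>p. 0 \<le> f p" "\<And>p. f p \<le> 1"
    and neg: "\<And>p. f p \<noteq> 0 \<Longrightarrow> Y p \<le> 0" and expint: "\<And>c. integrable N (\<lambda>p. exp (c * Y p))"
    and p_raw: "\<And>h. measure M {\<omega>\<in>space M. \<forall>x\<in>K. \<phi> x \<omega> \<in> (if x \<in> S then {h..} else {..<h})}
      = (\<integral>p. f p * exp (- h * Y p - h\<^sup>2 * cap E K / 2) \<partial>N)"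
    by (rule level_event_laplace[OF gff K, where S = S]) (erule interior, rule that)
  have p: "p h = (\<integral>p. f p * exp (- h * Y p - h\<^sup>2 * cap E K / 2) \<partial>N)" for h
    unfolding p_def by (rule p_raw)
  define L where "L z = (CLINT p|N. f p *\<^sub>R exp (z * Y p))" for z :: complex
  define G where "G z = L (- z) * exp (- z\<^sup>2 * cap E K / 2)" for z :: complex
  have "L holomorphic_on UNIV"
    unfolding L_def by (rule holomorphic_laplace) (use f expint in \<open>auto simp: abs_of_nonneg\<close>)
  then have "(L \<circ> uminus) holomorphic_on UNIV"
    by (intro holomorphic_on_compose holomorphic_intros) (auto intro: holomorphic_on_subset)
  then have "G holomorphic_on UNIV"
    unfolding G_def comp_def by (intro holomorphic_intros) simp_all
  moreover have "G (complex_of_real h) = complex_of_real (p h)" for h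
  proof -
    have "f q *\<^sub>R exp (- complex_of_real h * Y q) * exp (- (complex_of_real h)\<^sup>2 * cap E K / 2)
        = complex_of_real (f q * exp (- h * Y q - h\<^sup>2 * cap E K / 2))" for q
    proof -
      have "exp (- complex_of_real h * Y q) = complex_of_real (exp (- h * Y q))"
        "exp (- (complex_of_real h)\<^sup>2 * cap E K / 2) = complex_of_real (exp (- (h\<^sup>2 * cap E K / 2)))"
        by (simp_all add: exp_of_real[symmetric])
      moreover have "exp (- h * Y q - h\<^sup>2 * cap E K / 2) = exp (- h * Y q) * exp (- (h\<^sup>2 * cap E K / 2))"
        by (simp add: exp_add[symmetric])
      ultimately show ?thesis
        by (simp only: scaleR_conv_of_real of_real_mult mult.assoc)
    qed
    then show ?thesis
      unfolding G_def L_def p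
      by (simp only: integral_mult_left_zero[symmetric] integral_complex_of_real[symmetric])
  qed
  moreover have "norm (G z) \<le> exp (- ((Re z)\<^sup>2 - (Im z)\<^sup>2) / 2 * cap E K) * p 0" if "Re z \<le> 0" for z
  proof -
    have f_int: "integrable N f"
      by (rule Bochner_Integration.integrable_bound[OF expint[of 0]]) (use f in auto)
    have "norm (L (- z)) \<le> (\<integral>q. norm (f q *\<^sub>R exp (- z * Y q)) \<partial>N)"
      unfolding L_def by (rule integral_norm_bound)
    also have "\<dots> \<le> (\<integral>q. f q \<partial>N)"
    proof (rule integral_mono_AE')
      show "AE q in N. norm (f q *\<^sub>R exp (- z * Y q)) \<le> f q"
      proof (rule AE_I2)
        fix q
        show "norm (f q *\<^sub>R exp (- z * Y q)) \<le> f q"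
        proof (cases "f q = 0")
          case False
          then have "0 \<le> Re z * Y q"
            using neg that by (simp add: mult_nonpos_nonpos)
          then show ?thesis
            using f by (simp add: abs_of_nonneg mult_left_le)
        qed simp
      qed
    qed (use f_int f in auto)
    also have "\<dots> = p 0" by (simp add: p)
    finally have L_le: "norm (L (- z)) \<le> p 0" .
    have "norm (exp (- z\<^sup>2 * cap E K / 2)) = exp (- ((Re z)\<^sup>2 - (Im z)\<^sup>2) / 2 * cap E K)"
      by (simp add: power2_eq_square field_simps)
    then show ?thesis
      unfolding G_def norm_mult mult.commute[of "norm (L (- z))"]
      by (simp only:) (rule mult_left_mono[OF L_le], simp)
  qed
  ultimately show thesis by (rule that)
qed

end

section \<open>Probabilities of the values of the cluster\<close>

context transient_graph
begin

lemma cluster_prob_entire: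
  fixes M :: "'w measure" and \<phi> :: "'v \<Rightarrow> 'w \<Rightarrow> real"
  assumes gff: "is_gff E M \<phi>" and X: "finite X" "X \<noteq> {}" and S: "finite S"
  defines "p \<equiv> \<lambda>h. measure M {\<omega>\<in>space M. level_cluster E \<phi> X h \<omega> = S}"
  shows "\<exists>G. G holomorphic_on UNIV \<and> (\<forall>h. G (complex_of_real h) = complex_of_real (p h)) \<and>
    (\<forall>z. Re z \<le> 0 \<longrightarrow> (Im z)\<^sup>2 \<le> (Re z)\<^sup>2 \<longrightarrow>
      norm (G z) \<le> exp (- ((Re z)\<^sup>2 - (Im z)\<^sup>2) / 2 * cap E (sclosure E S)) * p 0)"
    and "{\<omega>\<in>space M. level_cluster E \<phi> X h \<omega> = S} \<in> sets M"
proof -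
  have [measurable]: "\<phi> x \<in> borel_measurable M" for x
    using gff by (simp add: is_gff_def)
  \<comment> \<open>Points of \<open>X\<close> outside \<open>S\<close> must lie below the level
    too. Including \<open>X\<close> also keeps \<open>K\<close> nonempty when \<open>S\<close> is
    empty.\<close>
  define K where "K = sclosure E S \<union> X"
  have K: "finite K" "K \<noteq> {}" "S \<subseteq> K"
    using X finite_sclosure[OF S] by (auto simp: K_def sclosure_def)
  have int: "nbrs E x \<subseteq> K" if "x \<in> S" for x
    using nbrs_subset_sclosure[OF that] by (auto simp: K_def)
  have ev: "level_cluster E \<phi> X h \<omega> = S \<longleftrightarrow> clusters_of E S X = S \<and>
      (\<forall>x\<in>K. \<phi> x \<omega> \<in> (if x \<in> S then {h..} else {..<h}))" for h \<omega>
  proof -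
    have "level_cluster E \<phi> X h \<omega> = S \<longleftrightarrow> clusters_of E S X = S \<and>
        S \<subseteq> {v. h \<le> \<phi> v \<omega>} \<and> (K - S) \<inter> {v. h \<le> \<phi> v \<omega>} = {}"
      unfolding level_cluster_def K_def by (rule clusters_of_eq_iff[OF sym])
    also have "S \<subseteq> {v. h \<le> \<phi> v \<omega>} \<and> (K - S) \<inter> {v. h \<le> \<phi> v \<omega>} = {} \<longleftrightarrow>
        (\<forall>x\<in>K. \<phi> x \<omega> \<in> (if x \<in> S then {h..} else {..<h}))"
      using K(3) by (auto simp: not_le[symmetric])
    finally show ?thesis .
  qed
  have [measurable]: "(if x \<in> S then {h..} else {..<h}) \<in> sets borel" for x and h :: real
    by simp
  show "{\<omega>\<in>space M. level_cluster E \<phi> X h \<omega> = S} \<in> sets M"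
    unfolding ev using K(1) by measurable
  show "\<exists>G. G holomorphic_on UNIV \<and> (\<forall>h. G (complex_of_real h) = complex_of_real (p h)) \<and>
    (\<forall>z. Re z \<le> 0 \<longrightarrow> (Im z)\<^sup>2 \<le> (Re z)\<^sup>2 \<longrightarrow>
      norm (G z) \<le> exp (- ((Re z)\<^sup>2 - (Im z)\<^sup>2) / 2 * cap E (sclosure E S)) * p 0)"
  proof (cases "clusters_of E S X = S")
    case True
    then have p: "p = (\<lambda>h. measure M {\<omega>\<in>space M. \<forall>x\<in>K. \<phi> x \<omega> \<in> (if x \<in> S then {h..} else {..<h})})"
      by (simp add: p_def ev)
    obtain G where G: "G holomorphic_on UNIV" "\<And>h. G (complex_of_real h) = complex_of_real (p h)"
      "\<And>z. Re z \<le> 0 \<Longrightarrow> norm (G z) \<le> exp (- ((Re z)\<^sup>2 - (Im z)\<^sup>2) / 2 * cap E K) * p 0"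
      by (rule level_event_entire[OF gff K(1,2), where S = S]) (erule int, rule that, simp_all only: p)
    have "norm (G z) \<le> exp (- ((Re z)\<^sup>2 - (Im z)\<^sup>2) / 2 * cap E (sclosure E S)) * p 0"
      if z: "Re z \<le> 0" "(Im z)\<^sup>2 \<le> (Re z)\<^sup>2" for z
    proof (rule order.trans[OF G(3)[OF z(1)]], intro mult_right_mono)
      \<comment> \<open>A larger capacity only decreases the exponential, since its coefficient is
        nonpositive for \<open>(Im z)\<^sup>2 \<le> (Re z)\<^sup>2\<close>.\<close>
      have "cap E (sclosure E S) \<le> cap E K"
        using K(1) by (intro cap_mono) (auto simp: K_def)
      then show "exp (- ((Re z)\<^sup>2 - (Im z)\<^sup>2) / 2 * cap E K)
          \<le> exp (- ((Re z)\<^sup>2 - (Im z)\<^sup>2) / 2 * cap E (sclosure E S))"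
        using z by (auto intro!: mult_left_mono_neg)
      show "0 \<le> p 0" by (simp add: p_def)
    qed
    with G show ?thesis by blast
  next
    \<comment> \<open>Such an \<open>S\<close> is not a value of the cluster at any level, so its
      probability is identically 0.\<close>
    case False
    then have "p = (\<lambda>_. 0)" by (simp add: p_def ev)
    then show ?thesis by (intro exI[of _ "\<lambda>_. 0"]) auto
  qed
qed

end

section \<open>Summation over the finite clusters and analyticity\<close>

theorem theorem1p5:
  fixes E :: "'v \<Rightarrow> 'v \<Rightarrow> bool"
    and M :: "'w measure"
    and \<phi> :: "'v \<Rightarrow> 'w \<Rightarrow> real"
    and F :: "'v set \<Rightarrow> complex"
    and X :: "'v set"
  assumes sym: "\<And>x y. E x y \<Longrightarrow> E y x"
    and irrefl: "\<And>x. \<not> E x x"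
    and locfin: "\<And>x. finite (nbrs E x)"
    and conn: "\<And>x y. E\<^sup>*\<^sup>* x y"
    and nonisol: "\<And>x. nbrs E x \<noteq> {}"
    and trans: "transient E"
    and gff: "is_gff E M \<phi>"
    and growth: "subexp_growth E F"
    and finX: "finite X"
  shows "(\<forall>h<0. integrable M (\<lambda>\<omega>. if finite (level_cluster E \<phi> X h \<omega>)
                                 then F (level_cluster E \<phi> X h \<omega>) else 0))
       \<and> real_analytic_on (\<lambda>h. integral\<^sup>L M (\<lambda>\<omega>. if finite (level_cluster E \<phi> X h \<omega>)
                                 then F (level_cluster E \<phi> X h \<omega>) else 0)) {..<0}"
proof (cases "X = {}")
  \<comment> \<open>With no starting points the cluster is always empty and the expectation is the
    constant \<open>F {}\<close>.\<close>
  case True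
  interpret M: prob_space M using gff by (simp add: is_gff_def)
  have "level_cluster E \<phi> X h \<omega> = {}" for h \<omega>
    by (simp add: level_cluster_def clusters_of_def True)
  moreover have "(\<lambda>n. (if n = 0 then F {} else 0) * y ^ n) sums F {}" for y
    using sums_single[of 0 "\<lambda>n. F {} * y ^ n"] by (simp add: if_distrib[of "\<lambda>c. c * _"] cong: if_cong)
  ultimately show ?thesis
    by (auto simp: real_analytic_on_def M.prob_space intro!: exI[of _ 1] exI[of _ "\<lambda>n. if n = 0 then F {} else 0"])
next
  case False
  interpret transient_graph E
    by unfold_locales (fact sym locfin conn nonisol trans)+
  interpret M: prob_space M using gff by (simp add: is_gff_def)
  let ?C = "level_cluster E \<phi> X"
  let ?f = "\<lambda>h \<omega>. if finite (?C h \<omega>) then F (?C h \<omega>) else 0"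
  define \<F> where "\<F> = {S :: 'v set. finite S}"
  have cF: "countable \<F>"
  proof -
    have "\<F> = {S. finite S \<and> S \<subseteq> UNIV}" by (simp add: \<F>_def)
    then show ?thesis using countable_Collect_finite_subset[OF countable_vertices] by simp
  qed
  have "\<F> \<noteq> {}" by (auto simp: \<F>_def)
  \<comment> \<open>Indices \<open>n\<close> outside the range of the encoding carry the junk set \<open>T n\<close> and are made inactive.\<close>
  define T where "T = from_nat_into \<F>"
  define active where "active n \<longleftrightarrow> to_nat_on \<F> (T n) = n" for n
  have T: "finite (T n)" for n
    using from_nat_into[OF \<open>\<F> \<noteq> {}\<close>] by (auto simp: T_def \<F>_def)
  have idx: "active n \<and> S = T n \<longleftrightarrow> n = to_nat_on \<F> S" if "finite S" for n S
    using that cF from_nat_into_to_nat_on[OF cF, of S] by (auto simp: active_def T_def \<F>_def)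
  define Ev where "Ev h n = {\<omega>\<in>space M. active n \<and> ?C h \<omega> = T n}" for h n
  have Ev_sets[measurable]: "Ev h n \<in> sets M" for h n
    using cluster_prob_entire(2)[OF gff finX False T, of h n] by (cases "active n") (auto simp: Ev_def)
  have disj: "disjoint_family (Ev h)" for h
    unfolding disjoint_family_on_def Ev_def active_def by auto
  have "\<exists>G. G holomorphic_on UNIV \<and> (\<forall>h. G (complex_of_real h) = complex_of_real (measure M (Ev h n))) \<and>
    (\<forall>z. Re z \<le> 0 \<longrightarrow> (Im z)\<^sup>2 \<le> (Re z)\<^sup>2 \<longrightarrow>
      norm (G z) \<le> exp (- ((Re z)\<^sup>2 - (Im z)\<^sup>2) / 2 * cap E (sclosure E (T n))) * measure M (Ev 0 n))" for n
  proof (cases "active n")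
    case True
    then show ?thesis
      using cluster_prob_entire(1)[OF gff finX False T, of n] by (simp add: Ev_def)
  next
    case False
    then show ?thesis by (intro exI[of _ "\<lambda>_. 0"]) (simp add: Ev_def)
  qed
  then obtain G where G_hol: "\<And>n. G n holomorphic_on UNIV"
    and G_real: "\<And>n h. G n (complex_of_real h) = complex_of_real (measure M (Ev h n))"
    and G_le: "\<And>n z. Re z \<le> 0 \<Longrightarrow> (Im z)\<^sup>2 \<le> (Re z)\<^sup>2 \<Longrightarrow>
      norm (G n z) \<le> exp (- ((Re z)\<^sup>2 - (Im z)\<^sup>2) / 2 * cap E (sclosure E (T n))) * measure M (Ev 0 n)"
    by metis
  \<comment> \<open>Disjoint events at level 0; their probabilities serve as the common majorant for
    all negative levels.\<close>
  have summable_p: "summable (\<lambda>n. measure M (Ev 0 n))"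
    by (rule sums_summable, rule M.finite_measure_UNION[OF _ disj]) (use Ev_sets in auto)

  \<comment> \<open>Growth at rate \<open>\<eta>\<close> is absorbed where the Gaussian decay rate
    \<open>((Re z)\<^sup>2 - (Im z)\<^sup>2) / 2\<close> is at least \<open>\<eta>\<close>,
    uniformly in \<open>n\<close>.\<close>
  have bound: "\<exists>C. \<forall>n z. Re z \<le> 0 \<longrightarrow> 2 * \<eta> \<le> (Re z)\<^sup>2 - (Im z)\<^sup>2 \<longrightarrow>
      norm (F (T n) * G n z) \<le> C * measure M (Ev 0 n)" if "0 < \<eta>" for \<eta>
  proof -
    obtain C where C: "\<And>S. finite S \<Longrightarrow> norm (F S) \<le> C * exp (\<eta> * cap E (sclosure E S))"
      using growth \<open>0 < \<eta>\<close> unfolding subexp_growth_def by blast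
    \<comment> \<open>The growth bound at the empty set dominates a norm, which forces the sign of
      \<open>C\<close>.\<close>
    have C0: "0 \<le> C"
      using order.trans[OF norm_ge_zero C[of "{}"]] by (simp add: zero_le_mult_iff)
    have "norm (F (T n) * G n z) \<le> C * measure M (Ev 0 n)"
      if z: "Re z \<le> 0" "2 * \<eta> \<le> (Re z)\<^sup>2 - (Im z)\<^sup>2" for n z
    proof -
      define c where "c = cap E (sclosure E (T n))"
      have c: "0 \<le> c" unfolding c_def cap_eq by (intro sum_nonneg equi_nonneg)
      have "norm (F (T n) * G n z) \<le> (C * exp (\<eta> * c)) *
          (exp (- ((Re z)\<^sup>2 - (Im z)\<^sup>2) / 2 * c) * measure M (Ev 0 n))"
        unfolding norm_mult c_def using z \<open>0 < \<eta>\<close> C0 by (intro mult_mono C T G_le) auto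
      also have "\<dots> = C * (exp (\<eta> * c + - ((Re z)\<^sup>2 - (Im z)\<^sup>2) / 2 * c) * measure M (Ev 0 n))"
        by (simp add: exp_add)
      also have "\<dots> \<le> C * (1 * measure M (Ev 0 n))"
      proof (intro mult_left_mono mult_right_mono C0)
        have "\<eta> * c \<le> ((Re z)\<^sup>2 - (Im z)\<^sup>2) / 2 * c"
          using z c by (intro mult_right_mono) auto
        then show "exp (\<eta> * c + - ((Re z)\<^sup>2 - (Im z)\<^sup>2) / 2 * c) \<le> 1"
          by (simp add: field_simps)
      qed simp
      finally show ?thesis by simp
    qed
    then show ?thesis by blast
  qed

  have main: "integrable M (?f h) \<and> (\<lambda>n. F (T n) * G n (complex_of_real h)) sums integral\<^sup>L M (?f h)"
    if "h < 0" for h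
  proof -
    define u where "u n \<omega> = indicator (Ev h n) \<omega> *\<^sub>R F (T n)" for n \<omega>
    have u_int: "integrable M (u n)" for n
      unfolding u_def by (intro integrable_scaleR_left integrable_real_indicator) (auto simp: M.emeasure_eq_measure)
    have u_sums: "(\<lambda>n. norm (u n \<omega>)) sums norm (?f h \<omega>)" "(\<lambda>n. u n \<omega>) sums ?f h \<omega>"
      if "\<omega> \<in> space M" for \<omega>
    proof -
      \<comment> \<open>For a finite cluster only its own index contributes. For an infinite one
        every term is 0 and the value of \<open>k\<close> is immaterial.\<close>
      define k where "k = to_nat_on \<F> (?C h \<omega>)"
      have u_eq: "u n \<omega> = (if n = k then ?f h \<omega> else 0)" for n
      proof (cases "finite (?C h \<omega>)")
        case True
        from idx[OF this, of n] show ?thesis using that True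
          by (auto simp: u_def Ev_def indicator_def k_def)
      next
        case False
        then have "?C h \<omega> \<noteq> T n" using T[of n] by auto
        with False show ?thesis by (simp add: u_def Ev_def)
      qed
      show "(\<lambda>n. u n \<omega>) sums ?f h \<omega>"
        unfolding u_eq by (rule sums_single)
      have norm_u_eq: "norm (u n \<omega>) = (if n = k then norm (?f h \<omega>) else 0)" for n
        unfolding u_eq by simp
      show "(\<lambda>n. norm (u n \<omega>)) sums norm (?f h \<omega>)"
        unfolding norm_u_eq by (rule sums_single)
    qed
    have u_integral: "(CLINT \<omega>|M. u n \<omega>) = F (T n) * G n (complex_of_real h)"
      "(\<integral>\<omega>. norm (u n \<omega>) \<partial>M) = norm (F (T n) * G n (complex_of_real h))" for n
      by (simp_all add: u_def G_real norm_mult scaleR_conv_of_real mult.commute)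
    \<comment> \<open>The largest admissible rate at the real point \<open>h\<close>, where the
      imaginary part is 0.\<close>
    have "0 < h\<^sup>2 / 2" using \<open>h < 0\<close> by simp
    from bound[OF this] obtain C where "\<And>n z. Re z \<le> 0 \<Longrightarrow> 2 * (h\<^sup>2 / 2) \<le> (Re z)\<^sup>2 - (Im z)\<^sup>2 \<Longrightarrow>
        norm (F (T n) * G n z) \<le> C * measure M (Ev 0 n)" by blast
    then have C: "norm (F (T n) * G n (complex_of_real h)) \<le> C * measure M (Ev 0 n)" for n
      using \<open>h < 0\<close> by simp
    have "summable (\<lambda>n. \<integral>\<omega>. norm (u n \<omega>) \<partial>M)"
      unfolding u_integral
      by (rule summable_comparison_test'[OF summable_mult[OF summable_p, of C]]) (use C in simp)
    moreover have "AE \<omega> in M. summable (\<lambda>n. norm (u n \<omega>))"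
      using u_sums(1) by (auto intro!: AE_I2 sums_summable)
    moreover have eq: "(\<Sum>n. u n \<omega>) = ?f h \<omega>" if "\<omega> \<in> space M" for \<omega>
      using u_sums(2)[OF that] by (simp only: sums_iff)
    ultimately have "integrable M (\<lambda>\<omega>. \<Sum>n. u n \<omega>)" "(\<lambda>n. CLINT \<omega>|M. u n \<omega>) sums (CLINT \<omega>|M. \<Sum>n. u n \<omega>)"
      by (auto intro!: integrable_suminf sums_integral u_int)
    moreover have "integral\<^sup>L M (\<lambda>\<omega>. \<Sum>n. u n \<omega>) = integral\<^sup>L M (?f h)"
      by (rule Bochner_Integration.integral_cong[OF refl eq])
    moreover have "integrable M (\<lambda>\<omega>. \<Sum>n. u n \<omega>) \<longleftrightarrow> integrable M (?f h)"
      by (rule Bochner_Integration.integrable_cong[OF refl eq])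
    ultimately show ?thesis
      by (simp only: u_integral simp_thms)
  qed

  have "\<exists>r>0. \<exists>c. \<forall>h. \<bar>h - h0\<bar> < r \<longrightarrow> (\<lambda>n. c n * complex_of_real ((h - h0) ^ n)) sums integral\<^sup>L M (?f h)"
    if "h0 < 0" for h0
  proof -
    \<comment> \<open>On the disc of this radius \<open>Re z \<le> - 3 * r\<close> and
      \<open>\<bar>Im z\<bar> \<le> r\<close>, so the difference of squares is at least
      \<open>9 * r\<^sup>2 - r\<^sup>2\<close>, twice the rate \<open>4 * r\<^sup>2\<close>.\<close>
    define r where "r = - h0 / 4"
    have r: "0 < r" using that by (simp add: r_def)
    define D where "D = cball (complex_of_real h0) r"
    have D: "Re z \<le> 0 \<and> 2 * (4 * r\<^sup>2) \<le> (Re z)\<^sup>2 - (Im z)\<^sup>2" if "z \<in> D" for z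
    proof -
      have "\<bar>Re z - h0\<bar> \<le> r" "\<bar>Im z\<bar> \<le> r"
        using that abs_Re_le_cmod[of "z - complex_of_real h0"] abs_Im_le_cmod[of "z - complex_of_real h0"]
        by (auto simp: D_def dist_norm norm_minus_commute)
      then have b: "3 * r \<le> - Re z" "\<bar>Im z\<bar> \<le> r" by (auto simp: r_def)
      have "(3 * r)\<^sup>2 \<le> (- Re z)\<^sup>2" "\<bar>Im z\<bar>\<^sup>2 \<le> r\<^sup>2"
        using r by (intro power_mono b; simp)+
      moreover have "Re z \<le> 0" using b r by linarith
      ultimately show ?thesis by (simp add: power_mult_distrib)
    qed
    have "0 < 4 * r\<^sup>2" using r by simp
    from bound[OF this] D obtain C
      where C: "\<And>n z. z \<in> D \<Longrightarrow> norm (F (T n) * G n z) \<le> C * measure M (Ev 0 n)"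
      by blast
    define H where "H z = (\<Sum>n. F (T n) * G n z)" for z
    \<comment> \<open>The M-test applies because the majorants do not depend on \<open>z\<close>;
      the uniform limit of holomorphic partial sums is then holomorphic.\<close>
    have unif: "uniform_limit (cball (complex_of_real h0) r) (\<lambda>n z. \<Sum>i<n. F (T i) * G i z) H sequentially"
      unfolding H_def D_def[symmetric] by (rule Weierstrass_m_test[OF C summable_mult[OF summable_p]])
    have "(\<lambda>z. \<Sum>i<n. F (T i) * G i z) holomorphic_on UNIV" for n
      by (intro holomorphic_intros G_hol)
    then have "\<forall>\<^sub>F n in sequentially. continuous_on (cball (complex_of_real h0) r) (\<lambda>z. \<Sum>i<n. F (T i) * G i z) \<and>
        (\<lambda>z. \<Sum>i<n. F (T i) * G i z) holomorphic_on ball (complex_of_real h0) r"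
      by (intro always_eventually allI conjI)
        (meson holomorphic_on_imp_continuous_on holomorphic_on_subset subset_UNIV)+
    from this unif trivial_limit_sequentially have H: "H holomorphic_on ball (complex_of_real h0) r"
      by (rule holomorphic_uniform_limit)
    have "(\<lambda>n. (deriv ^^ n) H (complex_of_real h0) / fact n * complex_of_real ((h - h0) ^ n)) sums integral\<^sup>L M (?f h)"
      if "\<bar>h - h0\<bar> < r" for h
    proof -
      \<comment> \<open>The real points of the disc stay negative, so there \<open>H\<close> is the
        expectation and its Taylor series is the required expansion.\<close>
      have "h < 0" using that r by (auto simp: r_def)
      then have "H (complex_of_real h) = integral\<^sup>L M (?f h)"
        using main[of h] unfolding H_def by (simp only: sums_iff)
      moreover have "complex_of_real h \<in> ball (complex_of_real h0) r"
        using that by (simp add: dist_real_def abs_minus_commute)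
      ultimately show ?thesis
        using holomorphic_power_series[OF H, of "complex_of_real h"] by simp
    qed
    with r show ?thesis
      by (intro exI[of _ r] exI[of _ "\<lambda>n. (deriv ^^ n) H (complex_of_real h0) / fact n"] conjI allI impI)
  qed
  then show ?thesis
    unfolding real_analytic_on_def by (intro conjI allI impI ballI) (simp_all add: main)
qed

end
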